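(* Let $H$ and $T$ be abundant acyclic quivers on disjoint vertex sets with reddening source sequences $\mathbf S_H$ and $\mathbf S_T$. Fix a mutation sequence $\mathbf N$ of vertices of $H$ and a mutation sequence $\mathbf M$ of vertices of $T$ such that the sequence $\mathbf M^{-1}\mathbf S_T\mathbf M\mathbf N^{-1}\mathbf S_H\mathbf N$ is reduced, and let $A\ne0$ be a nonnegative integer $|T|\times|H|$ matrix. Then $\mathbf M^{-1}\mathbf S_T\mathbf M\mathbf N^{-1}\mathbf S_H\mathbf N$ is a simple mutation cycle of $Q=\mu_{\mathbf M}(T)\stackrel{A}{\rightarrow}\mu_{\mathbf N}(H)$.
   Context: A quiver is a finite directed graph with labeled vertices, multiple arrows allowed, with no loops and no directed $2$-cycles; equality means equality of labeled graphs. $b_{xy}$ is the number of arrows $x\to y$ minus the number of arrows $y\to x$. A quiver is abundant if $|b_{ij}|\ge 2$ for all distinct $i,j$, and acyclic if it has no oriented cycles. Mutation $\mu_i$: for each path $u\to i\to v$ add an arrow $u\to v$; reverse all arrows at $i$; delete a maximal collection of oriented $2$-cycles; $\mu_{\mathbf i}=\mu_{i_m}\circ\cdots\circ\mu_{i_1}$ for $\mathbf i=i_1,\dots,i_m$; $\mathbf i^{-1}=i_m,\dots,i_1$; juxtaposition is concatenation; a sequence is reduced if no two consecutive entries are equal. The framed quiver $\widehat Q$ adds a frozen vertex $i'$ and an arrow $i\to i'$ for each vertex $i$; mutations only at mutable vertices. A reddening sequence for $Q$ is a sequence such that every mutable vertex $j$ of the resulting mutation of $\widehat Q$ satisfies $b_{ji'}\le0$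 for all frozen $i'$. A source sequence of an acyclic quiver is a sequence $v_1,\dots,v_k$ such that any arrow $v_i\to v_j$ has $i<j$; a reddening source sequence is a source sequence that is also a reddening sequence. For quivers $T',H'$ on disjoint vertex sets and a nonnegative integer $|T'|\times|H'|$ matrix $A=(a_{th})$, $T'\stackrel{A}{\rightarrow}H'$ is the quiver containing $T'$, $H'$ as full subquivers with exactly $a_{th}$ arrows $t\to h$ and no other arrows between them. A mutation cycle of $Q$ is a sequence $\mathbf i=i_1,\dots,i_m$ with no two consecutive entries equal and $\mu_{\mathbf i}(Q)=Q$; it is simple if the quivers $Q,\mu_{i_1}(Q),\dots,\mu_{i_{m-1}}\cdots\mu_{i_1}(Q)$ are pairwise distinct. *)

theory Defs
  imports Main
begin

text \<open>
  Arrows have no identity of their own: a quiver is given by its vertex set together with the number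
  of arrows between any two vertices. As \<open>arrows\<close> vanishes outside \<open>verts\<close>, HOL equality of two
  quivers is equality of labeled graphs.
\<close>

record 'a quiver =
  verts :: "'a set"
  arrows :: "'a \<Rightarrow> 'a \<Rightarrow> nat"

definition is_quiver :: "'a quiver \<Rightarrow> bool" where
  "is_quiver Q \<longleftrightarrow>
     finite (verts Q) \<and>
     (\<forall>u v. arrows Q u v > 0 \<longrightarrow> u \<in> verts Q \<and> v \<in> verts Q) \<and>
     (\<forall>v. arrows Q v v = 0) \<and>
     (\<forall>u v. arrows Q u v = 0 \<or> arrows Q v u = 0)"

definition bmat :: "'a quiver \<Rightarrow> 'a \<Rightarrow> 'a \<Rightarrow> int" where
  "bmat Q x y = int (arrows Q x y) - int (arrows Q y x)"

definition abundant :: "'a quiver \<Rightarrow> bool" where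
  "abundant Q \<longleftrightarrow> (\<forall>i\<in>verts Q. \<forall>j\<in>verts Q. i \<noteq> j \<longrightarrow> \<bar>bmat Q i j\<bar> \<ge> 2)"

definition acyclic_quiver :: "'a quiver \<Rightarrow> bool" where
  "acyclic_quiver Q \<longleftrightarrow> acyclic {(u, v). arrows Q u v > 0}"

definition add_paths :: "'a \<Rightarrow> 'a quiver \<Rightarrow> 'a quiver" where
  "add_paths i Q = Q\<lparr>arrows := \<lambda>u v. arrows Q u v + arrows Q u i * arrows Q i v\<rparr>"

definition reverse_at :: "'a \<Rightarrow> 'a quiver \<Rightarrow> 'a quiver" where
  "reverse_at i Q =
     Q\<lparr>arrows := \<lambda>u v. if u = i \<or> v = i then arrows Q v u else arrows Q u v\<rparr>"

text \<open>
  A maximal collection of oriented 2-cycles on \<open>{u, v}\<close> uses \<open>min (arrows Q u v) (arrows Q v u)\<close>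
  arrows of either direction.
\<close>

definition delete_2cycles :: "'a quiver \<Rightarrow> 'a quiver" where
  "delete_2cycles Q =
     Q\<lparr>arrows := \<lambda>u v. arrows Q u v - min (arrows Q u v) (arrows Q v u)\<rparr>"

definition mutate :: "'a \<Rightarrow> 'a quiver \<Rightarrow> 'a quiver" where
  "mutate i Q = delete_2cycles (reverse_at i (add_paths i Q))"

text \<open>The head of the list is the first vertex at which we mutate.\<close>

definition mutate_seq :: "'a list \<Rightarrow> 'a quiver \<Rightarrow> 'a quiver" where
  "mutate_seq is Q = fold mutate is Q"

datatype 'a fvert = Mutable 'a | Frozen 'a

definition framed :: "'a quiver \<Rightarrow> 'a fvert quiver" where
  "framed Q =
     \<lparr>verts = Mutable ` verts Q \<union> Frozen ` verts Q,
      arrows = \<lambda>x y.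
        case (x, y) of
          (Mutable u, Mutable v) \<Rightarrow> arrows Q u v
        | (Mutable u, Frozen v) \<Rightarrow> (if u = v \<and> u \<in> verts Q then 1 else 0)
        | _ \<Rightarrow> 0\<rparr>"

definition reddening :: "'a quiver \<Rightarrow> 'a list \<Rightarrow> bool" where
  "reddening Q is \<longleftrightarrow>
     set is \<subseteq> verts Q \<and>
     (\<forall>j\<in>verts Q. \<forall>i\<in>verts Q.
        bmat (mutate_seq (map Mutable is) (framed Q)) (Mutable j) (Frozen i) \<le> 0)"

definition source_sequence :: "'a quiver \<Rightarrow> 'a list \<Rightarrow> bool" where
  "source_sequence Q vs \<longleftrightarrow>
     set vs \<subseteq> verts Q \<and>
     (\<forall>i<length vs. \<forall>j<length vs. arrows Q (vs ! i) (vs ! j) > 0 \<longrightarrow> i < j)"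

definition reddening_source_sequence :: "'a quiver \<Rightarrow> 'a list \<Rightarrow> bool" where
  "reddening_source_sequence Q vs \<longleftrightarrow> source_sequence Q vs \<and> reddening Q vs"

text \<open>Only the entries \<open>A t h\<close> with \<open>t \<in> verts T\<close> and \<open>h \<in> verts H\<close> matter.\<close>

definition join_quiver :: "'a quiver \<Rightarrow> ('a \<Rightarrow> 'a \<Rightarrow> nat) \<Rightarrow> 'a quiver \<Rightarrow> 'a quiver" where
  "join_quiver T A H =
     \<lparr>verts = verts T \<union> verts H,
      arrows = \<lambda>u v.
        if u \<in> verts T \<and> v \<in> verts T then arrows T u v
        else if u \<in> verts H \<and> v \<in> verts H then arrows H u v
        else if u \<in> verts T \<and> v \<in> verts H then A u v
        else 0\<rparr>"

definition mutation_cycle :: "'a quiver \<Rightarrow> 'a list \<Rightarrow> bool" where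
  "mutation_cycle Q is \<longleftrightarrow> set is \<subseteq> verts Q \<and> distinct_adj is \<and> mutate_seq is Q = Q"

definition simple_mutation_cycle :: "'a quiver \<Rightarrow> 'a list \<Rightarrow> bool" where
  "simple_mutation_cycle Q is \<longleftrightarrow>
     mutation_cycle Q is \<and>
     distinct (map (\<lambda>k. mutate_seq (take k is) Q) [0..<length is])"

end

theory Submission
  imports Defs
begin

text \<open>
  Mutation paths leading away from an acyclic abundant quiver only meet forks (Warkentin): the vertex
  mutated last is a point of return \<open>r\<close>, and every path \<open>i \<rightarrow> r \<rightarrow> j\<close> closes to a triangle with more
  arrows \<open>j \<rightarrow> i\<close> than \<open>i \<rightarrow> r\<close> or \<open>r \<rightarrow> j\<close>. In place of the general sign-coherence theorem we
  pull a nonnegative column at the far end of such a path back to its start. The rows of the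
  matrix of this pull-back are computed by walking the path outwards, where the choice in each
  exchange relation is governed by a two-colouring of the vertices; the fork inequalities make a row
  grow, so that it keeps its sign. Hence no arrows inside \<open>\<mu>\<^sub>N(H)\<close> are created while mutating in \<open>T\<close>.

  A source sequence of \<open>T\<close>, read backwards, is itself a path of this kind. It returns to \<open>T\<close> and turns
  the all-green starting data into the all-red one, so pulling \<open>A\<close> back along \<open>S\<^sub>T\<inverse> M\<close> agrees with pulling
  \<open>-A\<close> back along \<open>M\<close>. Therefore \<open>M\<inverse> S\<^sub>T M\<close> reverses all arrows between the two parts, and the
  second half of the cycle reverses them again.

  For simplicity of the cycle, the total number of arrows of the \<open>T\<close>-part strictly increases along
  \<open>M\<close>, and the acyclic quivers met along \<open>S\<^sub>T\<close> are distinct apart from the two ends; thus equal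
  \<open>T\<close>-parts only occur at mirrored times, and equality of the whole quivers there would give \<open>A = -A\<close>.
\<close>

section \<open>Forks\<close>

definition mutate_matrix :: "'a \<Rightarrow> ('a \<Rightarrow> 'a \<Rightarrow> int) \<Rightarrow> 'a \<Rightarrow> 'a \<Rightarrow> int" where
  "mutate_matrix r b i j =
     (if i = r \<or> j = r then - b i j
      else b i j + max (b i r) 0 * max (b r j) 0 - max (- b i r) 0 * max (- b r j) 0)"

text \<open>
  \<open>x t\<close> counts the arrows from \<open>t\<close> to one fixed vertex at which we never mutate.
\<close>

definition mutate_column :: "'a \<Rightarrow> ('a \<Rightarrow> 'a \<Rightarrow> int) \<Rightarrow> ('a \<Rightarrow> int) \<Rightarrow> 'a \<Rightarrow> int" where
  "mutate_column r b x t =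
     (if t = r then - x r
      else x t + max (b t r) 0 * max (x r) 0 - max (- b t r) 0 * max (- x r) 0)"

definition skew :: "('a \<Rightarrow> 'a \<Rightarrow> int) \<Rightarrow> bool" where
  "skew b \<longleftrightarrow> (\<forall>i j. b i j = - b j i)"

text \<open>
  \<open>P\<close> holds the point of return: it is \<open>{r}\<close> after a mutation at \<open>r\<close> and empty for an acyclic quiver.
\<close>

definition fork :: "'a set \<Rightarrow> 'a set \<Rightarrow> ('a \<Rightarrow> 'a \<Rightarrow> int) \<Rightarrow> bool" where
  "fork I P b \<longleftrightarrow>
     skew b \<and>
     (\<forall>i\<in>I. \<forall>j\<in>I. i \<noteq> j \<longrightarrow> \<bar>b i j\<bar> \<ge> 2) \<and>
     (\<forall>i\<in>I - P. \<forall>j\<in>I - P. \<forall>k\<in>I - P. b i j > 0 \<longrightarrow> b j k > 0 \<longrightarrow> b i k > 0) \<and>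
     (\<forall>s\<in>P. \<forall>i\<in>I. \<forall>j\<in>I. b i s > 0 \<longrightarrow> b s j > 0 \<longrightarrow> b j i > b i s \<and> b j i > b s j)"

lemma skewD: "skew b \<Longrightarrow> b i j = - b j i"
  unfolding skew_def by (drule spec, drule spec)

lemma skew_self: "skew b \<Longrightarrow> b i i = 0"
  by (rule equal_neg_zero[THEN iffD1, OF skewD])

lemma skew_mutate_matrix: "skew b \<Longrightarrow> skew (mutate_matrix r b)"
  unfolding skew_def
proof (intro allI)
  fix i j assume h: "\<forall>i j. b i j = - b j i"
  have e: "b j i = - b i j" "b r i = - b i r" "b j r = - b r j" using h by blast+
  show "mutate_matrix r b i j = - mutate_matrix r b j i" unfolding mutate_matrix_def e by (simp add: algebra_simps)
qed

lemma mutate_matrix_mutate_matrix: "mutate_matrix r (mutate_matrix r b) = b"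
  by (intro ext) (simp add: mutate_matrix_def)

lemma mutate_matrix_uminus: "mutate_matrix r (\<lambda>i j. - b i j) = (\<lambda>i j. - mutate_matrix r b i j)"
  by (intro ext) (simp add: mutate_matrix_def algebra_simps)

context
  fixes I P :: "'a set" and b :: "'a \<Rightarrow> 'a \<Rightarrow> int"
  assumes fork: "fork I P b"
begin

lemma fork_skew: "b i j = - b j i"
  by (rule skewD) (use fork in \<open>simp add: fork_def\<close>)

lemma fork_self: "b i i = 0"
  by (rule equal_neg_zero[THEN iffD1, OF fork_skew])

lemma fork_abundant: "i \<in> I \<Longrightarrow> j \<in> I \<Longrightarrow> i \<noteq> j \<Longrightarrow> \<bar>b i j\<bar> \<ge> 2"
  using fork unfolding fork_def by blast

lemma fork_ge2: "i \<in> I \<Longrightarrow> j \<in> I \<Longrightarrow> b i j > 0 \<Longrightarrow> b i j \<ge> 2"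
  using fork_abundant[of i j] fork_self[of i] by force

lemma fork_trans: 
  "i \<in> I \<Longrightarrow> j \<in> I \<Longrightarrow> k \<in> I \<Longrightarrow> i \<notin> P \<Longrightarrow> j \<notin> P \<Longrightarrow> k \<notin> P \<Longrightarrow> b i j > 0 \<Longrightarrow> b j k > 0 \<Longrightarrow> b i k > 0"
  using fork unfolding fork_def by blast

lemma fork_return:
  "s \<in> P \<Longrightarrow> i \<in> I \<Longrightarrow> j \<in> I \<Longrightarrow> b i s > 0 \<Longrightarrow> b s j > 0 \<Longrightarrow> b j i > b i s \<and> b j i > b s j"
  using fork unfolding fork_def by blast

text \<open>Outside \<open>P\<close> the arrows are transitive, so the oriented triangle contains a
  point of return. The fork inequality makes the side opposite to that point the heaviest.\<close>

lemma fork_triangle: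
  assumes "r \<in> I" "r \<notin> P" "i \<in> I" "j \<in> I" "b i r > 0" "b r j > 0" "b j i > 0"
  shows "i \<in> P \<and> b r j > b j i \<and> b r j > b i r \<or> j \<in> P \<and> b i r > b r j \<and> b i r > b j i"
proof -
  have "i \<in> P \<or> j \<in> P"
  proof (rule ccontr)
    assume "\<not> (i \<in> P \<or> j \<in> P)"
    then have "b i j > 0" using fork_trans[of i r j] assms by auto
    then show False using fork_skew[of i j] assms by simp
  qed
  then show ?thesis
    using fork_return[of i j r] fork_return[of j r i] assms by auto
qed

text \<open>Abundance makes the product at least twice either factor, and by
  \<open>fork_triangle\<close> an opposing entry \<open>b j i\<close> is smaller than one of the
  factors. The strict bounds by \<open>b i r\<close> and \<open>b r j\<close> restore the fork
  inequalities, the comparison of absolute values makes the number of arrows grow, and the last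
  three bounds feed the growth of rows.\<close>

lemma mutate_matrix_path:
  assumes "r \<in> I" "r \<notin> P" "i \<in> I" "j \<in> I" "b i r > 0" "b r j > 0"
  shows "mutate_matrix r b i j = b i j + b i r * b r j"
    and "mutate_matrix r b i j > b i r" and "mutate_matrix r b i j > b r j"
    and "\<bar>mutate_matrix r b i j\<bar> > \<bar>b i j\<bar>"
    and "2 * mutate_matrix r b i j \<ge> 2 * max (b i j) 0 + b i r * b r j"
    and "2 * max (- b i j) 0 \<le> b i r * b r j"
    and "j \<in> P \<or> b i j > 0 \<Longrightarrow> mutate_matrix r b i j \<ge> 2 * b r j"
proof -
  have ne: "i \<noteq> r" "j \<noteq> r" "i \<noteq> j" using assms fork_self fork_skew[of i r] by fastforce+
  show eq: "mutate_matrix r b i j = b i j + b i r * b r j"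
    using ne assms by (simp add: mutate_matrix_def max_def)
  have g: "b i r \<ge> 2" "b r j \<ge> 2" using assms fork_ge2 by auto
  have m1: "b i r * b r j \<ge> 2 * b r j" using g by (simp add: mult_right_mono)
  have m2: "b i r * b r j \<ge> 2 * b i r" using g by (simp add: mult.commute mult_left_mono)
  have "b i j \<noteq> 0" using fork_abundant[of i j] assms ne by auto
  then consider (p) "b i j > 0" | (n) "b i j < 0" by linarith
  then have *: "mutate_matrix r b i j > b i r \<and> mutate_matrix r b i j > b r j \<and> \<bar>mutate_matrix r b i j\<bar> > \<bar>b i j\<bar> \<and>
     2 * mutate_matrix r b i j \<ge> 2 * max (b i j) 0 + b i r * b r j \<and> 2 * max (- b i j) 0 \<le> b i r * b r j \<and>
     (j \<in> P \<or> b i j > 0 \<longrightarrow> mutate_matrix r b i j \<ge> 2 * b r j)"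
  proof cases
    case p
    define z where "z = b i r * b r j"
    show ?thesis unfolding eq using m1 m2 g p unfolding z_def[symmetric] by auto
  next
    case n
    then have ji: "b j i > 0" "b i j = - b j i" using fork_skew[of i j] by auto
    from fork_triangle[OF assms ji(1)] show ?thesis
    proof (elim disjE conjE)
      assume h: "i \<in> P" "b r j > b j i" "b r j > b i r"
      \<comment> \<open>If both ends lie in \<open>P\<close>, the inequalities at the two points of
        return contradict each other.\<close>
      show ?thesis
      proof (cases "j \<in> P")
        case True
        then have "b i r > b r j" using fork_return[of j r i] assms ji by auto
        then show ?thesis using h by simp
      next
        case False
        define z where "z = b i r * b r j"
        show ?thesis unfolding eq using m1 m2 g h ji False unfolding z_def[symmetric] by auto
      qed
    next
      assume h: "j \<in> P" "b i r > b r j" "b i r > b j i"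
      \<comment> \<open>From \<open>b i r >= b r j + 1\<close> and \<open>b j i < b i r\<close>,
        what is left of the product after subtracting \<open>b j i\<close> is at least the square of
        \<open>b r j\<close>.\<close>
      have "(b r j - 1) * b i r \<ge> (b r j - 1) * (b r j + 1)"
        using h g by (intro mult_left_mono) auto
      moreover have "b r j * b r j \<ge> 2 * b r j" using g by (simp add: mult_right_mono)
      ultimately have "b i r * b r j - b i r + 1 \<ge> 2 * b r j" by (simp add: algebra_simps)
      moreover define z where "z = b i r * b r j"
      ultimately show ?thesis unfolding eq using m1 m2 g h ji unfolding z_def[symmetric] by auto
    qed
  qed
  then show "mutate_matrix r b i j > b i r" "mutate_matrix r b i j > b r j" "\<bar>mutate_matrix r b i j\<bar> > \<bar>b i j\<bar>"
     "2 * mutate_matrix r b i j \<ge> 2 * max (b i j) 0 + b i r * b r j" "2 * max (- b i j) 0 \<le> b i r * b r j"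
     "j \<in> P \<or> b i j > 0 \<Longrightarrow> mutate_matrix r b i j \<ge> 2 * b r j"
    by blast+
qed

lemma mutate_matrix_no_path:
  assumes "i \<noteq> r" "j \<noteq> r" "\<not> (b i r > 0 \<and> b r j > 0)" "\<not> (b r i > 0 \<and> b j r > 0)"
  shows "mutate_matrix r b i j = b i j"
  using assms fork_skew[of i r] fork_skew[of r j] by (auto simp: mutate_matrix_def max_def)

lemma fork_uminus: "fork I P (\<lambda>i j. - b i j)"
  unfolding fork_def
proof (intro conjI ballI impI)
  show "skew (\<lambda>i j. - b i j)" unfolding skew_def using fork_skew by (metis)
next
  fix i j k assume "i \<in> I - P" "j \<in> I - P" "k \<in> I - P" "- b i j > 0" "- b j k > 0"
  then have "b k i > 0" using fork_trans[of k j i] fork_skew[of i j] fork_skew[of j k] by auto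
  then show "- b i k > 0" using fork_skew[of i k] by simp
next
  fix s i j assume h: "s \<in> P" "i \<in> I" "j \<in> I" "- b i s > 0" "- b s j > 0"
  then have "b i j > b j s \<and> b i j > b s i" 
    using fork_return[of s j i] fork_skew[of i s] fork_skew[of s j] by auto
  then show "- b j i > - b i s" "- b j i > - b s j"
    using fork_skew[of i s] fork_skew[of s j] fork_skew[of i j] by auto
qed (use fork_abundant in auto)

text \<open>Warkentin's key property of forks. Afterwards every tail of \<open>r\<close> has arrows
  to every head of \<open>r\<close>, while arrows among the tails or among the heads are unchanged.
  An oriented triangle avoiding \<open>r\<close> therefore lies on one side of \<open>r\<close> and
  was there before, which the old fork forbids.\<close>

lemma fork_mutate_matrix:
  assumes r: "r \<in> I" "r \<notin> P"
  shows "fork I {r} (mutate_matrix r b)"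
  unfolding fork_def
proof (intro conjI ballI impI)
  show sk: "skew (mutate_matrix r b)" using skew_mutate_matrix fork by (auto simp: fork_def)
  show "\<bar>mutate_matrix r b i j\<bar> \<ge> 2" if ij: "i \<in> I" "j \<in> I" "i \<noteq> j" for i j
  proof -
    consider "i = r \<or> j = r" | "i \<noteq> r" "j \<noteq> r" "b i r > 0" "b r j > 0"
      | "i \<noteq> r" "j \<noteq> r" "b r i > 0" "b j r > 0"
      | "i \<noteq> r" "j \<noteq> r" "\<not> (b i r > 0 \<and> b r j > 0)" "\<not> (b r i > 0 \<and> b j r > 0)" by blast
    then show ?thesis
    proof cases
      case 1 then show ?thesis using fork_abundant[OF ij] by (simp add: mutate_matrix_def)
    next
      case 2 then show ?thesis using mutate_matrix_path(2)[of r i j] fork_ge2[of i r] r ij by auto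
    next
      case 3 then show ?thesis using mutate_matrix_path(2)[of r j i] fork_ge2[of j r] r ij skewD[OF sk, of i j] by auto
    next
      case 4 then show ?thesis using mutate_matrix_no_path fork_abundant[OF ij] by simp
    qed
  qed
  have side: "mutate_matrix r b i j = b i j" if "i \<noteq> r" "j \<noteq> r" "b i r > 0 \<longleftrightarrow> b j r > 0" "i \<in> I" "j \<in> I" for i j
    using mutate_matrix_no_path[of i r j] that fork_skew[of r i] fork_skew[of r j] by auto
  \<comment> \<open>If \<open>i\<close> is a point of return on \<open>k -> i -> r\<close>, then
    there are arrows from \<open>r\<close> back to \<open>k\<close>, so \<open>k\<close> is not a
    tail of \<open>r\<close>; dually for three heads.\<close>
  have tri: False if "i \<in> I" "j \<in> I" "k \<in> I" "b i j > 0" "b j k > 0" "b k i > 0"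
    "b i r > 0 \<and> b j r > 0 \<and> b k r > 0 \<or> b r i > 0 \<and> b r j > 0 \<and> b r k > 0" "i \<in> P" for i j k
  proof -
    from that(7) show False
    proof (elim disjE conjE)
      assume "b i r > 0" "b k r > 0"
      then show False using fork_return[of i k r] that r fork_skew[of k r] by auto
    next
      assume "b r i > 0" "b r j > 0"
      then show False using fork_return[of i r j] that r fork_skew[of j r] by auto
    qed
  qed
  have cyc: False if "i \<in> I" "j \<in> I" "k \<in> I" "b i j > 0" "b j k > 0" "b k i > 0"
    "b i r > 0 \<and> b j r > 0 \<and> b k r > 0 \<or> b r i > 0 \<and> b r j > 0 \<and> b r k > 0" for i j k
  proof -
    have "i \<in> P \<or> j \<in> P \<or> k \<in> P"
      using fork_trans[of i j k] fork_skew[of i k] that by auto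
    then show False using tri[of i j k] tri[of j k i] tri[of k i j] that by blast
  qed
  fix i j k assume h: "i \<in> I - {r}" "j \<in> I - {r}" "k \<in> I - {r}" "mutate_matrix r b i j > 0" "mutate_matrix r b j k > 0"
  have sgn: "b u r > 0 \<or> b r u > 0" if "u \<in> I - {r}" for u
    using fork_abundant[of u r] fork_skew[of u r] that r by force
  have mix: "mutate_matrix r b u v > 0" if "u \<in> I - {r}" "v \<in> I - {r}" "b u r > 0" "b r v > 0" for u v
    using mutate_matrix_path(2)[of r u v] that r by auto
  show "mutate_matrix r b i k > 0"
  proof (rule ccontr)
    assume n: "\<not> ?thesis"
    have ik: "i \<noteq> k" using h skewD[OF sk, of i j] by auto
    have "mutate_matrix r b i k \<noteq> 0"
      using \<open>\<And>j i. i \<in> I \<Longrightarrow> j \<in> I \<Longrightarrow> i \<noteq> j \<Longrightarrow> 2 \<le> \<bar>mutate_matrix r b i j\<bar>\<close>[of i k] h ik by auto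
    then have ki: "mutate_matrix r b k i > 0" using n skewD[OF sk, of i k] by auto
    \<comment> \<open>Arrows between the two sides lead from tails to heads of \<open>r\<close>, so
      a predecessor of a tail is a tail. Going once around the triangle puts all three vertices on
      one side.\<close>
    have ns: "b v r > 0" if "mutate_matrix r b v u > 0" "b u r > 0" "u \<in> I - {r}" "v \<in> I - {r}" for u v
      using that mix[of u v] sgn[of u] sgn[of v] skewD[OF sk, of u v] by fastforce
    have all: "b i r > 0 \<longleftrightarrow> b j r > 0" "b j r > 0 \<longleftrightarrow> b k r > 0"
      using ns[of i j] ns[of j k] ns[of k i] h ki by auto
    then have "b i j > 0" "b j k > 0" "b k i > 0" using side h ki by auto
    then show False using cyc[of i j k] all h sgn by (metis Diff_iff)
  qed
next
  fix s i j assume h: "s \<in> {r}" "i \<in> I" "j \<in> I" "mutate_matrix r b i s > 0" "mutate_matrix r b s j > 0"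
  then have p: "b r i > 0" "b j r > 0" using fork_skew[of i r] fork_skew[of j r] by (auto simp: mutate_matrix_def)
  show "mutate_matrix r b i s < mutate_matrix r b j i" "mutate_matrix r b s j < mutate_matrix r b j i"
    using mutate_matrix_path(2,3)[of r j i] p h r fork_skew[of i r] fork_skew[of r j] by (auto simp: mutate_matrix_def)
qed

end

section \<open>Colourings and growing rows\<close>

text \<open>
  The colours 1 (green) and -1 (red) play the part of the signs of c-vectors: a mutation at a green
  vertex changes the c-vectors at the heads of its outgoing arrows, and these become green.
\<close>

definition recolor :: "'a \<Rightarrow> ('a \<Rightarrow> 'a \<Rightarrow> int) \<Rightarrow> ('a \<Rightarrow> int) \<Rightarrow> 'a \<Rightarrow> int" where
  "recolor r b e t = (if t = r then - e r else if e r * b r t > 0 then e r else e t)"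

text \<open>
  This is one coordinate of the exchange relation of g-vectors, with \<open>e r\<close> as tropical sign.
\<close>

definition mutate_row ::
    "'a set \<Rightarrow> 'a \<Rightarrow> ('a \<Rightarrow> 'a \<Rightarrow> int) \<Rightarrow> ('a \<Rightarrow> int) \<Rightarrow> ('a \<Rightarrow> int) \<Rightarrow> 'a \<Rightarrow> int" where
  "mutate_row I r b e w t = (if t = r then - w r + (\<Sum>k\<in>I. max (e r * b r k) 0 * w k) else w t)"

text \<open>The last clause records a mutation at \<open>s\<close>: the neighbours it recoloured
  took the old colour of \<open>s\<close>, so only vertices on the other side of \<open>s\<close>
  can share its new one.\<close>

definition colored :: "'a set \<Rightarrow> 'a set \<Rightarrow> ('a \<Rightarrow> 'a \<Rightarrow> int) \<Rightarrow> ('a \<Rightarrow> int) \<Rightarrow> bool" where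
  "colored I P b e \<longleftrightarrow>
     (\<forall>t\<in>I. e t = 1 \<or> e t = -1) \<and>
     (\<forall>t\<in>I - P. \<forall>u\<in>I - P. e t \<noteq> e u \<longrightarrow> e t * b t u < 0) \<and>
     (\<forall>s\<in>P. \<forall>t\<in>I. t \<noteq> s \<longrightarrow> e t = e s \<longrightarrow> e s * b s t < 0)"

text \<open>
  The factor 2 cannot be changed: since only \<open>\<bar>b u r\<bar> \<ge> 2\<close> is known, a factor \<open>c\<close> reproduces itself
  under mutation just when \<open>c\<^sup>2 \<le> 4 (c - 1)\<close>. The point of return itself may violate the first growth
  condition; the last one says that it will satisfy it after the next mutation.
\<close>

definition grown ::
    "'a set \<Rightarrow> 'a set \<Rightarrow> ('a \<Rightarrow> 'a \<Rightarrow> int) \<Rightarrow> ('a \<Rightarrow> int) \<Rightarrow> ('a \<Rightarrow> int) \<Rightarrow> bool" where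
  "grown I P b e w \<longleftrightarrow>
     (\<forall>u\<in>I. w u \<ge> 0) \<and>
     (\<forall>u\<in>I - P. 2 * w u \<le> (\<Sum>k\<in>I. max (e u * b u k) 0 * w k)) \<and>
     (\<forall>s\<in>P. \<forall>u\<in>I - P. e u \<noteq> e s \<longrightarrow> e s * b s u < 0 \<longrightarrow>
        2 * w s \<le> \<bar>b s u\<bar> * ((\<Sum>k\<in>I. max (e u * b u k) 0 * w k) - w u))"

text \<open>Reversing all arrows while exchanging the colours is a symmetry of the whole setting; it
  reduces every later argument to a green \<open>r\<close>.\<close>

lemma colored_uminus: "colored I P (\<lambda>i j. - b i j) (\<lambda>t. - e t) \<longleftrightarrow> colored I P b e"
proof -
  have "- x = 1 \<or> - x = -1 \<longleftrightarrow> x = 1 \<or> x = -1" for x :: int by linarith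
  then show ?thesis unfolding colored_def by simp
qed

lemma grown_uminus: "grown I P (\<lambda>i j. - b i j) (\<lambda>t. - e t) w \<longleftrightarrow> grown I P b e w"
  unfolding grown_def by simp

lemma recolor_uminus: "recolor r (\<lambda>i j. - b i j) (\<lambda>t. - e t) = (\<lambda>t. - recolor r b e t)"
  by (intro ext) (simp add: recolor_def)

lemma mutate_row_uminus: "mutate_row I r (\<lambda>i j. - b i j) (\<lambda>t. - e t) w = mutate_row I r b e w"
  by (intro ext) (simp add: mutate_row_def)

lemma fork_nz: "fork I P b \<Longrightarrow> i \<in> I \<Longrightarrow> j \<in> I \<Longrightarrow> i \<noteq> j \<Longrightarrow> b i j > 0 \<or> b j i > 0"
  using fork_abundant[of I P b i j] fork_skew[of I P b i j] by fastforce

lemma colored_recolor_1: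
  assumes f: "fork I P b" and r: "r \<in> I" "r \<notin> P" and e1: "e r = 1"
    and e: "\<forall>t\<in>I. e t = 1 \<or> e t = -1"
    and K1: "\<forall>t\<in>I - P. \<forall>u\<in>I - P. e t \<noteq> e u \<longrightarrow> e t * b t u < 0"
    and K2: "(\<forall>s\<in>P. \<forall>t\<in>I. t \<noteq> s \<longrightarrow> e t = e s \<longrightarrow> e s * b s t < 0) \<or> (\<forall>t\<in>I. e t = 1)"
  shows "colored I {r} (mutate_matrix r b) (recolor r b e)"
  unfolding colored_def
proof (intro conjI ballI impI)
  show "recolor r b e t = 1 \<or> recolor r b e t = -1" if "t \<in> I" for t
    using e r that e1 by (auto simp: recolor_def)
next
  fix s t assume "s \<in> {r}" "t \<in> I" "t \<noteq> s" "recolor r b e t = recolor r b e s"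
  then show "recolor r b e s * mutate_matrix r b s t < 0"
    using e1 fork_nz[OF f, of r t] r fork_skew[OF f, of t r]
    by (auto simp: recolor_def mutate_matrix_def split: if_splits)
next
  have main: "mutate_matrix r b u t > 0"
    if t: "t \<in> I" "t \<noteq> r" "recolor r b e t = 1" and u: "u \<in> I" "u \<noteq> r" "recolor r b e u = -1" for t u
  proof -
    have bu: "b u r > 0" and eu: "e u = -1"
      using u e1 fork_nz[OF f, of r u] r by (auto simp: recolor_def split: if_splits)
    have tu: "t \<noteq> u" using t u by auto
    show ?thesis
    proof (cases "b r t > 0")
      case True
      then show ?thesis using mutate_matrix_path(2)[OF f r, of u t] t u bu by auto
    next
      case False
      then have et: "e t = 1" using t by (auto simp: recolor_def split: if_splits)
      have btr: "b t r > 0" using False fork_nz[OF f, of r t] t r by auto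
      have "b u t > 0"
      proof (rule ccontr)
        assume "\<not> ?thesis"
        then have btu: "b t u > 0" using fork_nz[OF f, of t u] t u tu by auto
        have K2: "\<forall>s\<in>P. \<forall>t\<in>I. t \<noteq> s \<longrightarrow> e t = e s \<longrightarrow> e s * b s t < 0"
          using K2 u eu by force
        have "t \<notin> P" using K2 r et e1 btr t by force
        moreover have "u \<notin> P"
        proof
          assume "u \<in> P"
          then have "b r t > b t u" using fork_return[OF f, of u t r] t u r btu bu by auto
          then show False using False btu by simp
        qed
        ultimately have "e t * b t u < 0" using K1 t u et eu by force
        then show False using et btu by simp
      qed
      moreover have "mutate_matrix r b u t = b u t"
        using mutate_matrix_no_path[OF f, of u r t] t u False fork_skew[OF f, of r u] bu by auto
      ultimately show ?thesis by simp
    qed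
  qed
  have sk: "mutate_matrix r b i j = - mutate_matrix r b j i" for i j
    by (rule fork_skew[OF fork_mutate_matrix[OF f r]])
  fix t u assume h: "t \<in> I - {r}" "u \<in> I - {r}" "recolor r b e t \<noteq> recolor r b e u"
  have *: "recolor r b e v = 1 \<or> recolor r b e v = -1" if "v \<in> I" for v
    using e r that e1 by (auto simp: recolor_def)
  consider "recolor r b e t = 1" "recolor r b e u = -1" | "recolor r b e t = -1" "recolor r b e u = 1"
    using *[of t] *[of u] h by auto
  then show "recolor r b e t * mutate_matrix r b t u < 0"
  proof cases
    case 1 then show ?thesis using main[of t u] h sk[of t u] by auto
  next
    case 2 then show ?thesis using main[of u t] h by auto
  qed
qed

lemma colored_recolor:
  assumes f: "fork I P b" and r: "r \<in> I" "r \<notin> P"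
    and e: "colored I P b e \<or> (\<exists>c\<in>{1, -1}. \<forall>t\<in>I. e t = c)"
  shows "colored I {r} (mutate_matrix r b) (recolor r b e)"
proof -
  have er: "e r = 1 \<or> e r = -1" and e': "\<forall>t\<in>I. e t = 1 \<or> e t = -1" using e r unfolding colored_def by auto
  have K1: "\<forall>t\<in>I - P. \<forall>u\<in>I - P. e t \<noteq> e u \<longrightarrow> e t * b t u < 0"
    using e unfolding colored_def by auto
  have K2: "(\<forall>s\<in>P. \<forall>t\<in>I. t \<noteq> s \<longrightarrow> e t = e s \<longrightarrow> e s * b s t < 0) \<or> (\<forall>t\<in>I. e t = e r)"
    using e r unfolding colored_def by auto
  from er show ?thesis
  proof
    assume "e r = 1"
    then show ?thesis using colored_recolor_1[OF f r _ e' K1] K2 by auto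
  next
    assume m: "e r = -1"
    have "colored I {r} (mutate_matrix r (\<lambda>i j. - b i j)) (recolor r (\<lambda>i j. - b i j) (\<lambda>t. - e t))"
      by (rule colored_recolor_1[OF fork_uminus[OF f] r]) (use m e' K1 K2 in force)+
    then show ?thesis by (simp add: mutate_matrix_uminus recolor_uminus colored_uminus)
  qed
qed

text \<open>Entry \<open>r\<close> rises to \<open>X - w r >= w r\<close>. A head of
  \<open>r\<close> profits from this directly, and a green tail gains arrows to the heads of
  \<open>r\<close>. A red tail outside \<open>P\<close> may lose arrows from heads of
  \<open>r\<close>, but the new entry at \<open>r\<close> makes up for them; a red tail in
  \<open>P\<close> is the case prepared by the third growth condition.\<close>

lemma grown_mutate_row_1:
  assumes fin: "finite I" and f: "fork I P b" and r: "r \<in> I" "r \<notin> P" and e1: "e r = 1"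
    and col: "colored I P b e" and gr: "grown I P b e w"
  shows "grown I {r} (mutate_matrix r b) (recolor r b e) (mutate_row I r b e w)"
proof -
  define X where "X = (\<Sum>k\<in>I. max (b r k) 0 * w k)"
  have w0: "w u \<ge> 0" if "u \<in> I" for u using gr that unfolding grown_def by auto
  have G1: "2 * w u \<le> (\<Sum>k\<in>I. max (e u * b u k) 0 * w k)" if "u \<in> I" "u \<notin> P" for u
    using gr that unfolding grown_def by auto
  have G2: "2 * w s \<le> \<bar>b s u\<bar> * ((\<Sum>k\<in>I. max (e u * b u k) 0 * w k) - w u)"
    if "s \<in> P" "u \<in> I" "u \<notin> P" "e u \<noteq> e s" "e s * b s u < 0" for s u
    using gr that unfolding grown_def by auto
  have K2: "e s * b s t < 0" if "s \<in> P" "t \<in> I" "t \<noteq> s" "e t = e s" for s t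
    using col that unfolding colored_def by auto
  have epm: "e t = 1 \<or> e t = -1" if "t \<in> I" for t using col that unfolding colored_def by auto
  have Xr: "2 * w r \<le> X" using G1[of r] r e1 by (simp add: X_def)
  have wr: "mutate_row I r b e w r = X - w r" by (simp add: mutate_row_def X_def e1)
  have wn: "mutate_row I r b e w t = w t" if "t \<noteq> r" for t using that by (simp add: mutate_row_def)
  have w'0: "mutate_row I r b e w t \<ge> 0" if "t \<in> I" for t
    using w0[of r] w0[of t] that r Xr wr wn[of t] by (cases "t = r") auto
  define S' where "S' u = (\<Sum>k\<in>I. max (recolor r b e u * mutate_matrix r b u k) 0 * mutate_row I r b e w k)" for u
  define S where "S u = (\<Sum>k\<in>I. max (e u * b u k) 0 * w k)" for u
  have S'ge: "S' u \<ge> max (recolor r b e u * mutate_matrix r b u k) 0 * mutate_row I r b e w k" if "k \<in> I" for u k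
    unfolding S'_def using fin that w'0 by (intro member_le_sum) auto
  have S'split: "S' u = max (recolor r b e u * mutate_matrix r b u r) 0 * (X - w r)
      + (\<Sum>k\<in>I - {r}. max (recolor r b e u * mutate_matrix r b u k) 0 * w k)" for u
    unfolding S'_def using fin r by (subst sum.remove[of _ r]) (simp_all add: wr wn)
  have Ssplit: "S u = max (e u * b u r) 0 * w r + (\<Sum>k\<in>I - {r}. max (e u * b u k) 0 * w k)" for u
    unfolding S_def using fin r by (subst sum.remove[of _ r]) simp_all
  have Xsplit: "X = (\<Sum>k\<in>I - {r}. max (b r k) 0 * w k)"
    unfolding X_def using fin r fork_self[OF f, of r] by (subst sum.remove[of _ r]) simp_all
  \<comment> \<open>The first bound yields growth at \<open>u\<close>; the second serves the third
    growth condition, with \<open>r\<close> as new point of return.\<close>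
  have green: "2 * S' u \<ge> 2 * (S u - b u r * w r) + b u r * X \<and> S' u \<ge> 2 * X"
    if u: "u \<in> I" "u \<noteq> r" "b u r > 0" "e u = 1" for u
  proof -
    have c: "recolor r b e u = 1" using u e1 fork_skew[OF f, of r u] by (simp add: recolor_def)
    have pw: "2 * max (b u k) 0 + b u r * max (b r k) 0 \<le> 2 * max (mutate_matrix r b u k) 0 \<and>
        2 * max (b r k) 0 \<le> max (mutate_matrix r b u k) 0" if k: "k \<in> I - {r}" for k
    proof (cases "b r k > 0")
      case True
      \<comment> \<open>Otherwise \<open>u -> r -> k -> u\<close> is oriented with point of return
        \<open>u\<close>; but a green point of return has no green head, and \<open>r\<close> is
        one.\<close>
      have "b u k > 0 \<or> k \<in> P"
      proof (rule ccontr)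
        assume n: "\<not> ?thesis"
        have "k \<noteq> u" using True u fork_skew[OF f, of r u] by auto
        then have "b k u > 0" using n fork_nz[OF f, of u k] u k by auto
        then have "u \<in> P" using fork_triangle[OF f r, of u k] u k True n by auto
        then show False using K2[of u r] u r e1 by auto
      qed
      then show ?thesis using mutate_matrix_path(2,5,7)[OF f r, of u k] u k True by auto
    next
      case False
      have "mutate_matrix r b u k = b u k"
        using mutate_matrix_no_path[OF f, of u r k] u k False fork_skew[OF f, of r u] by auto
      then show ?thesis using False by auto
    qed
    have "2 * (\<Sum>k\<in>I - {r}. max (b u k) 0 * w k) + b u r * X
        \<le> 2 * (\<Sum>k\<in>I - {r}. max (mutate_matrix r b u k) 0 * w k)"
      unfolding Xsplit sum_distrib_left sum.distrib[symmetric]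
    proof (rule sum_mono)
      fix k assume k: "k \<in> I - {r}"
      have "(2 * max (b u k) 0 + b u r * max (b r k) 0) * w k \<le> (2 * max (mutate_matrix r b u k) 0) * w k"
        using pw[OF k] w0[of k] k by (intro mult_right_mono) auto
      then show "2 * (max (b u k) 0 * w k) + b u r * (max (b r k) 0 * w k)
          \<le> 2 * (max (mutate_matrix r b u k) 0 * w k)" by (simp add: algebra_simps)
    qed
    moreover have "2 * X \<le> (\<Sum>k\<in>I - {r}. max (mutate_matrix r b u k) 0 * w k)"
      unfolding Xsplit sum_distrib_left
    proof (rule sum_mono)
      fix k assume k: "k \<in> I - {r}"
      have "(2 * max (b r k) 0) * w k \<le> max (mutate_matrix r b u k) 0 * w k"
        using pw[OF k] w0[of k] k by (intro mult_right_mono) auto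
      then show "2 * (max (b r k) 0 * w k) \<le> max (mutate_matrix r b u k) 0 * w k" by (simp add: algebra_simps)
    qed
    moreover have "mutate_matrix r b u r < 0" using u by (simp add: mutate_matrix_def)
    ultimately show ?thesis
      unfolding S'split Ssplit c using u by (simp add: max_def)
  qed
  have step1: "2 * w u \<le> S' u" if u: "u \<in> I" "u \<noteq> r" for u
  proof -
    consider (a) "b r u > 0" | (b) "b u r > 0" "e u = 1" | (c) "b u r > 0" "e u = -1"
      using fork_nz[OF f, of u r] u r epm[of u] by auto
    then show ?thesis
    proof cases
      case a
      then have g: "b r u \<ge> 2" using fork_ge2[OF f] u r by auto
      have "max (b r u) 0 * w u \<le> X"
        unfolding X_def using fin u w0 by (intro member_le_sum) auto
      then have "b r u * w u \<le> X" using a by simp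
      \<comment> \<open>The critical case for the factor 2: passing from \<open>X\<close> to
        \<open>X - w r\<close> costs a factor 2, and the two factors \<open>b r u >= 2\<close>
        supply 4.\<close>
      then have "b r u * w u \<le> 2 * (X - w r)" using Xr by simp
      then have "b r u * (b r u * w u) \<le> b r u * (2 * (X - w r))" using g by (intro mult_left_mono) auto
      moreover have "b r u * (b r u * w u) \<ge> 2 * (2 * w u)"
        using g w0[of u] u by (intro mult_mono) auto
      moreover have "S' u \<ge> b r u * (X - w r)"
      proof -
        have "recolor r b e u = 1" using a u e1 by (simp add: recolor_def)
        moreover have "mutate_matrix r b u r = b r u" using fork_skew[OF f, of u r] by (simp add: mutate_matrix_def)
        ultimately show ?thesis using S'ge[of r u] r a wr by simp
      qed
      ultimately show ?thesis by (simp add: algebra_simps)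
    next
      case b
      have "u \<notin> P" using K2[of u r] b u r e1 by auto
      then have "2 * w u \<le> S u" using G1 u by (simp add: S_def)
      moreover define y z where "y = b u r * w r" and "z = b u r * X"
      have "b u r * (2 * w r) \<le> b u r * X" using Xr b by (intro mult_left_mono) auto
      then have "2 * y \<le> z" unfolding y_def z_def by (simp only: mult.left_commute[of _ 2])
      moreover have "2 * S' u \<ge> 2 * (S u - y) + z" using green[of u] u b y_def z_def by blast
      ultimately show ?thesis by presburger
    next
      case c
      have cs: "recolor r b e u = -1" using c u e1 fork_skew[OF f, of r u] by (simp add: recolor_def)
      have mr: "mutate_matrix r b u r = - b u r" by (simp add: mutate_matrix_def)
      show ?thesis
      proof (cases "u \<in> P")
        case True
        have "2 * w u \<le> \<bar>b u r\<bar> * (X - w r)"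
          using G2[of u r] True r c e1 by (simp add: X_def)
        then show ?thesis using S'ge[of r u] r c cs mr wr by simp
      next
        case False
        have pw: "2 * max (- b u k) 0 \<le> 2 * max (- mutate_matrix r b u k) 0 + b u r * max (b r k) 0"
          if k: "k \<in> I - {r}" for k
        proof (cases "b r k > 0")
          case True
          then show ?thesis using mutate_matrix_path(6)[OF f r, of u k] u k c by auto
        next
          case False
          have "mutate_matrix r b u k = b u k"
            using mutate_matrix_no_path[OF f, of u r k] u k c False fork_skew[OF f, of r u] by auto
          then show ?thesis using False by auto
        qed
        have "2 * (\<Sum>k\<in>I - {r}. max (- b u k) 0 * w k)
            \<le> 2 * (\<Sum>k\<in>I - {r}. max (- mutate_matrix r b u k) 0 * w k) + b u r * X"
          unfolding Xsplit sum_distrib_left sum.distrib[symmetric]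
        proof (rule sum_mono)
          fix k assume k: "k \<in> I - {r}"
          have "(2 * max (- b u k) 0) * w k \<le> (2 * max (- mutate_matrix r b u k) 0 + b u r * max (b r k) 0) * w k"
            using pw[OF k] w0[of k] k by (intro mult_right_mono) auto
          then show "2 * (max (- b u k) 0 * w k)
              \<le> 2 * (max (- mutate_matrix r b u k) 0 * w k) + b u r * (max (b r k) 0 * w k)"
            by (simp add: algebra_simps)
        qed
        moreover have "S u = (\<Sum>k\<in>I - {r}. max (- b u k) 0 * w k)" using c unfolding Ssplit by simp
        moreover have "S' u = b u r * (X - w r) + (\<Sum>k\<in>I - {r}. max (- mutate_matrix r b u k) 0 * w k)"
          using c unfolding S'split cs mr by simp
        moreover have "b u r * (2 * w r) \<le> b u r * X" using Xr c by (intro mult_left_mono) auto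
        moreover have "2 * w u \<le> S u" using G1 u False by (simp add: S_def)
        ultimately show ?thesis by (simp add: algebra_simps)
      qed
    qed
  qed
  show ?thesis unfolding grown_def S'_def[symmetric]
  proof (intro conjI ballI impI)
    fix u assume "u \<in> I - {r}"
    then show "2 * mutate_row I r b e w u \<le> S' u" using step1 wn by auto
  next
    fix s u assume h: "s \<in> {r}" "u \<in> I - {r}" "recolor r b e u \<noteq> recolor r b e s"
      "recolor r b e s * mutate_matrix r b s u < 0"
    have "b u r > 0" using h e1 fork_skew[OF f, of r u] by (auto simp: recolor_def mutate_matrix_def)
    moreover have "e u = 1"
      using h e1 epm[of u] calculation fork_skew[OF f, of r u] by (auto simp: recolor_def split: if_splits)
    ultimately have u: "u \<in> I" "u \<noteq> r" "b u r > 0" "e u = 1" using h by auto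
    have g: "b u r \<ge> 2" using fork_ge2[OF f] u r by auto
    have "2 * X \<le> S' u" using green u by auto
    moreover have "2 * w u \<le> S' u" using step1 u by auto
    \<comment> \<open>\<open>S' u\<close> is at least \<open>2 * X\<close> and at least
      \<open>2 * w u\<close>; averaging gives \<open>S' u - w u >= X\<close>.\<close>
    moreover have "2 * (S' u - w u) \<le> b u r * (S' u - w u)"
      using calculation g w0[of u] u w0[of r] Xr r by (intro mult_right_mono) auto
    moreover have "w r \<ge> 0" using w0 r by simp
    moreover define q where "q = b u r * (S' u - w u)"
    ultimately have "2 * (X - w r) \<le> q" by presburger
    moreover have "\<bar>mutate_matrix r b r u\<bar> = b u r" using u fork_skew[OF f, of r u] by (simp add: mutate_matrix_def)
    ultimately show "2 * mutate_row I r b e w s \<le> \<bar>mutate_matrix r b s u\<bar> * (S' u - mutate_row I r b e w u)"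
      using h wr wn u by (simp add: q_def)
  qed (use w'0 in auto)
qed

lemma grown_mutate_row:
  assumes "finite I" and f: "fork I P b" and r: "r \<in> I" "r \<notin> P"
    and col: "colored I P b e" and gr: "grown I P b e w"
  shows "grown I {r} (mutate_matrix r b) (recolor r b e) (mutate_row I r b e w)"
proof -
  have "e r = 1 \<or> e r = -1" using col r by (auto simp: colored_def)
  then show ?thesis
  proof
    assume "e r = 1"
    from grown_mutate_row_1[OF assms(1) f r this col gr] show ?thesis .
  next
    assume "e r = -1"
    then have "grown I {r} (mutate_matrix r (\<lambda>i j. - b i j)) (recolor r (\<lambda>i j. - b i j) (\<lambda>t. - e t))
        (mutate_row I r (\<lambda>i j. - b i j) (\<lambda>t. - e t) w)"
      using assms by (intro grown_mutate_row_1[OF _ fork_uminus[OF f]]) (auto simp: colored_uminus grown_uminus)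
    then show ?thesis by (simp add: mutate_matrix_uminus recolor_uminus mutate_row_uminus grown_uminus)
  qed
qed

text \<open>A unit row need not be grown, but the first mutation that changes it puts
  \<open>b r c >= 2\<close> at \<open>r\<close>. This supports the entry 1 at \<open>c\<close>, and
  a tail of \<open>r\<close> is supported by the arrows to \<open>c\<close> that the mutation
  creates. Only the values of the colouring enter, so the constant start of a walk is
  covered.\<close>

lemma grown_activate_1:
  assumes fin: "finite I" and f: "fork I P b" and r: "r \<in> I" "r \<notin> P" and e1: "e r = 1"
    and e: "\<forall>t\<in>I. e t = 1 \<or> e t = -1"
    and c: "c \<in> I" "c \<noteq> r" "b r c > 0"
  shows "grown I {r} (mutate_matrix r b) (recolor r b e) (mutate_row I r b e (\<lambda>t. if t = c then 1 else 0))"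
proof -
  let ?w = "\<lambda>t. if t = c then 1 else 0 :: int"
  have "(\<Sum>k\<in>I. max (b r k) 0 * ?w k) = b r c"
    using fin c by (simp add: if_distrib sum.delta cong: if_cong)
  then have w': "mutate_row I r b e ?w t = (if t = r then b r c else ?w t)" for t
    using c e1 by (auto simp: mutate_row_def)
  have w'0: "mutate_row I r b e ?w t \<ge> 0" for t using c by (auto simp: w')
  define S' where "S' u = (\<Sum>k\<in>I. max (recolor r b e u * mutate_matrix r b u k) 0 * mutate_row I r b e ?w k)" for u
  have S'ge: "S' u \<ge> max (recolor r b e u * mutate_matrix r b u k) 0 * mutate_row I r b e ?w k" if "k \<in> I" for u k
    unfolding S'_def using fin that w'0 by (intro member_le_sum) auto
  have g: "b r c \<ge> 2" using fork_ge2[OF f] r c by auto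
  show ?thesis unfolding grown_def S'_def[symmetric]
  proof (intro conjI ballI impI)
    fix u assume u: "u \<in> I - {r}"
    show "2 * mutate_row I r b e ?w u \<le> S' u"
    proof (cases "u = c")
      case True
      have "recolor r b e c = 1" "mutate_matrix r b c r = b r c"
        using c e1 fork_skew[OF f, of c r] by (auto simp: recolor_def mutate_matrix_def)
      then have "S' c \<ge> b r c * b r c" using S'ge[of r c] r g by (simp add: w')
      moreover have "b r c * b r c \<ge> 2 * 2" using g by (intro mult_mono) auto
      ultimately show ?thesis using True c by (simp add: w')
    next
      case False
      then show ?thesis using S'ge[of c u] c u by (simp add: w')
    qed
  next
    fix s u assume h: "s \<in> {r}" "u \<in> I - {r}" "recolor r b e u \<noteq> recolor r b e s"
      "recolor r b e s * mutate_matrix r b s u < 0"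
    have u: "b u r > 0" using h e1 fork_skew[OF f, of r u] by (auto simp: recolor_def mutate_matrix_def)
    have uc: "u \<noteq> c" using u c fork_skew[OF f, of r u] by auto
    have g': "b u r \<ge> 2" using fork_ge2[OF f] u h r by auto
    have "e u = 1 \<or> e u = -1" using e h by auto
    then have c1: "recolor r b e u = 1"
      using h e1 by (auto simp: recolor_def split: if_splits)
    have m: "mutate_matrix r b u c > b r c" using mutate_matrix_path(3)[OF f r, of u c] u h c by auto
    then have "S' u \<ge> b r c" using S'ge[of c u] c1 c g by (simp add: w')
    then have "2 * b r c \<le> b u r * S' u" using g g' by (intro mult_mono) auto
    then show "2 * mutate_row I r b e ?w s \<le> \<bar>mutate_matrix r b s u\<bar> * (S' u - mutate_row I r b e ?w u)"
      using u h uc fork_skew[OF f, of r u] by (simp add: w' mutate_matrix_def)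
  qed (use w'0 in auto)
qed

lemma grown_activate:
  assumes fin: "finite I" and f: "fork I P b" and r: "r \<in> I" "r \<notin> P"
    and e: "\<forall>t\<in>I. e t = 1 \<or> e t = -1"
    and c: "c \<in> I" "c \<noteq> r" "e r * b r c > 0"
  shows "grown I {r} (mutate_matrix r b) (recolor r b e) (mutate_row I r b e (\<lambda>t. if t = c then 1 else 0))"
proof -
  have "e r = 1 \<or> e r = -1" using e r by auto
  then show ?thesis
  proof
    assume "e r = 1"
    with c have "b r c > 0" by simp
    from grown_activate_1[OF fin f r \<open>e r = 1\<close> e c(1,2) this] show ?thesis .
  next
    assume "e r = -1"
    then have "grown I {r} (mutate_matrix r (\<lambda>i j. - b i j)) (recolor r (\<lambda>i j. - b i j) (\<lambda>t. - e t))
        (mutate_row I r (\<lambda>i j. - b i j) (\<lambda>t. - e t) (\<lambda>t. if t = c then 1 else 0))"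
      using assms by (intro grown_activate_1[OF _ fork_uminus[OF f]]) force+
    then show ?thesis by (simp add: mutate_matrix_uminus recolor_uminus mutate_row_uminus grown_uminus)
  qed
qed

section \<open>Transport along a mutation path\<close>

text \<open>
  \<open>transport_row\<close> walks outwards along a path. In \<open>pull_back b p a\<close> the column \<open>a\<close> sits at the far end of
  the path \<open>p\<close> that starts at \<open>b\<close>.
\<close>

fun transport_row ::
    "'a set \<Rightarrow> ('a \<Rightarrow> 'a \<Rightarrow> int) \<Rightarrow> ('a \<Rightarrow> int) \<Rightarrow> ('a \<Rightarrow> int) \<Rightarrow> 'a list \<Rightarrow> 'a \<Rightarrow> int" where
  "transport_row I b e w [] = w"
| "transport_row I b e w (r # p) = transport_row I (mutate_matrix r b) (recolor r b e) (mutate_row I r b e w) p"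

fun pull_back :: "('a \<Rightarrow> 'a \<Rightarrow> int) \<Rightarrow> 'a list \<Rightarrow> ('a \<Rightarrow> int) \<Rightarrow> 'a \<Rightarrow> int" where
  "pull_back b [] a = a"
| "pull_back b (r # p) a = mutate_column r (mutate_matrix r b) (pull_back (mutate_matrix r b) p a)"

definition unit_row :: "'a \<Rightarrow> int \<Rightarrow> 'a \<Rightarrow> int" where
  "unit_row c x = (\<lambda>t. if t = c then x else 0)"

lemma mutate_row_linear:
  "mutate_row I r b e (\<lambda>t. x * w1 t + y * w2 t) = (\<lambda>t. x * mutate_row I r b e w1 t + y * mutate_row I r b e w2 t)"
  by (intro ext) (simp add: mutate_row_def sum.distrib sum_distrib_left algebra_simps)

lemma transport_row_linear:
  "transport_row I b e (\<lambda>t. x * w1 t + y * w2 t) p = (\<lambda>t. x * transport_row I b e w1 p t + y * transport_row I b e w2 p t)"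
  by (induction p arbitrary: b e w1 w2) (simp_all add: mutate_row_linear)

lemma mutate_row_mult: "mutate_row I r b e (\<lambda>t. x * w t) = (\<lambda>t. x * mutate_row I r b e w t)"
  using mutate_row_linear[of I r b e x w 0 w] by simp

lemma transport_row_mult: "transport_row I b e (\<lambda>t. x * w t) p = (\<lambda>t. x * transport_row I b e w p t)"
  using transport_row_linear[of I b e x w 0 w] by simp

lemma transport_row_cong:
  "set p \<subseteq> I \<Longrightarrow> \<forall>t\<in>I. e t = e' t \<Longrightarrow> transport_row I b e w p = transport_row I b e' w p"
proof (induction p arbitrary: b e e' w)
  case (Cons r p)
  have "mutate_row I r b e w = mutate_row I r b e' w" using Cons.prems by (intro ext) (simp add: mutate_row_def)
  moreover have "\<forall>t\<in>I. recolor r b e t = recolor r b e' t" using Cons.prems by (simp add: recolor_def)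
  ultimately show ?case using Cons by auto
qed simp

lemma transport_row_grown:
  assumes fin: "finite I"
  shows "fork I P b \<Longrightarrow> colored I P b e \<Longrightarrow> grown I P b e w \<Longrightarrow> set p \<subseteq> I \<Longrightarrow> distinct_adj p \<Longrightarrow>
    (p \<noteq> [] \<Longrightarrow> hd p \<notin> P) \<Longrightarrow> t \<in> I \<Longrightarrow> transport_row I b e w p t \<ge> 0"
proof (induction p arbitrary: P b e w)
  case Nil
  then show ?case by (simp add: grown_def)
next
  case (Cons r p)
  have r: "r \<in> I" "r \<notin> P" using Cons.prems by auto
  have "p \<noteq> [] \<Longrightarrow> hd p \<notin> {r}" using Cons.prems(5) by (cases p) auto
  then have "transport_row I (mutate_matrix r b) (recolor r b e) (mutate_row I r b e w) p t \<ge> 0"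
    using Cons.prems r fin
    by (intro Cons.IH[of "{r}"] fork_mutate_matrix[of I P] colored_recolor[of I P] grown_mutate_row[of I P])
      (auto simp: distinct_adj_Cons)
  then show ?case by simp
qed

text \<open>This ensures that a mutation at \<open>c\<close> recolours no other vertex, under either
  colouring. A vertex \<open>t\<close> of the other colour would violate \<open>e\<close>, or, as a
  point of return, the colouring \<open>h\<close>, where it agrees with \<open>c\<close>.\<close>

lemma colored_neighbour:
  assumes "colored I P b e" "colored I P b h" "skew b"
    and "\<forall>t\<in>I. t \<noteq> c \<longrightarrow> h t = e t" "h c = - e c"
    and "c \<in> I" "c \<notin> P" "t \<in> I" "t \<noteq> c" "e c * b c t > 0"
  shows "e t = e c"
proof (rule ccontr)
  assume n: "e t \<noteq> e c"
  have pm: "e t = 1 \<or> e t = -1" "e c = 1 \<or> e c = -1" using assms(1,6,8) unfolding colored_def by auto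
  show False
  proof (cases "t \<in> P")
    case True
    have "h t = h c" using n pm assms by auto
    then have "h t * b t c < 0" using True assms unfolding colored_def by auto
    moreover have "h t = - e c" using \<open>h t = h c\<close> assms by simp
    ultimately show False using assms(10) skewD[OF assms(3), of t c] by simp
  next
    case False
    then have "e c * b c t < 0" using n assms unfolding colored_def by auto
    then show False using assms(10) by simp
  qed
qed

text \<open>
  Prepending a step at \<open>c\<close> to a path changes the colouring \<open>e\<close> of the shorter path to \<open>h\<close>. As long as
  row \<open>c\<close> is a multiple of a unit vector, the two colourings differ at \<open>c\<close> only; after the first mutation
  that makes row \<open>c\<close> grow they coincide. \<open>B\<close> is column \<open>c\<close> of the matrix where the shorter path starts,
  and the hypothesis on \<open>B\<close> is what remains of the duality \<open>W b W\<^sup>T = B\<close> when row \<open>c\<close> of \<open>W\<close> is a unit vector.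
\<close>

lemma transport_row_connect:
  assumes fin: "finite I" and c: "c \<in> I"
  shows "fork I P b \<Longrightarrow> set p \<subseteq> I \<Longrightarrow> distinct_adj p \<Longrightarrow> (p \<noteq> [] \<Longrightarrow> hd p \<notin> P) \<Longrightarrow>
    colored I P b h \<Longrightarrow> colored I P b e \<or> c \<in> P \<and> (\<exists>k\<in>{1, -1}. \<forall>t\<in>I. e t = k) \<Longrightarrow>
    \<forall>t\<in>I. t \<noteq> c \<longrightarrow> h t = e t \<Longrightarrow> h c = - e c \<Longrightarrow>
    \<forall>u\<in>I - {c}. (\<Sum>t\<in>I. w u t * b t c) = e c * B u \<Longrightarrow>
    \<exists>d\<in>{1, -1}. (\<forall>t\<in>I. d * transport_row I b e (unit_row c (e c)) p t \<ge> 0) \<and>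
      (\<forall>u\<in>I - {c}. transport_row I b h (\<lambda>t. w u t + max (e c * B u) 0 * unit_row c (e c) t) p =
         (\<lambda>t. transport_row I b e (w u) p t + max (d * B u) 0 * transport_row I b e (unit_row c (e c)) p t)) \<and>
      transport_row I b h (\<lambda>t. - unit_row c (e c) t) p = (\<lambda>t. - transport_row I b e (unit_row c (e c)) p t)"
proof (induction p arbitrary: P b e h w)
  case Nil
  have "e c = 1 \<or> e c = -1" using Nil.prems(6) c unfolding colored_def by auto
  then show ?case by (intro bexI[of _ "e c"]) (auto simp: unit_row_def)
next
  case (Cons r p)
  note f = Cons.prems(1) and hcol = Cons.prems(5) and ecol = Cons.prems(6) and agree = Cons.prems(7)
    and hc = Cons.prems(8) and Z = Cons.prems(9)
  have r: "r \<in> I" "r \<notin> P" using Cons.prems by auto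
  have p: "set p \<subseteq> I" "distinct_adj p" "p \<noteq> [] \<Longrightarrow> hd p \<notin> {r}"
    using Cons.prems(2,3) by (cases p; auto)+
  have f': "fork I {r} (mutate_matrix r b)" using fork_mutate_matrix[OF f r] .
  have hcol': "colored I {r} (mutate_matrix r b) (recolor r b h)" using colored_recolor[OF f r] hcol by blast
  have ecol': "colored I {r} (mutate_matrix r b) (recolor r b e)" using colored_recolor[OF f r] ecol by blast
  have pm: "\<forall>t\<in>I. e t = 1 \<or> e t = -1" using ecol unfolding colored_def by auto
  have sk: "b i j = - b j i" for i j by (rule fork_skew[OF f])
  have bcc: "b c c = 0" by (rule fork_self[OF f])
  have sumunit: "(\<Sum>k\<in>I. g k * unit_row c x k) = g c * x" for g x
    using fin c by (simp add: unit_row_def if_distrib sum.delta cong: if_cong)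
  consider (act) "r \<noteq> c" "e r * b r c > 0" | (idle) "r \<noteq> c" "e r * b r c < 0" | (self) "r = c"
    using fork_nz[OF f r(1) c] pm r sk[of r c] by fastforce
  then show ?case
  proof cases
    case act
    \<comment> \<open>A mutation at \<open>r\<close> that reaches \<open>c\<close> gives
      \<open>c\<close> the colour of \<open>r\<close> in both colourings, so from here on they
      agree. The row is activated and keeps the sign \<open>e c\<close>.\<close>
    have same: "transport_row I b h v (r # p) = transport_row I b e v (r # p)" for v
    proof -
      have "mutate_row I r b h v = mutate_row I r b e v" using agree act r by (intro ext) (simp add: mutate_row_def)
      moreover have "transport_row I (mutate_matrix r b) (recolor r b h) v' p = transport_row I (mutate_matrix r b) (recolor r b e) v' p" for v'
        using p agree act r by (intro transport_row_cong) (auto simp: recolor_def)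
      ultimately show ?thesis by simp
    qed
    have u1: "unit_row c (e c) = (\<lambda>t. e c * (if t = c then 1 else 0))" by (auto simp: unit_row_def)
    have "grown I {r} (mutate_matrix r b) (recolor r b e) (mutate_row I r b e (\<lambda>t. if t = c then 1 else 0))"
      using grown_activate[OF fin f r pm c] act by auto
    then have "transport_row I b e (\<lambda>t. if t = c then 1 else 0) (r # p) t \<ge> 0" if "t \<in> I" for t
      using transport_row_grown[OF fin f' ecol' _ p] that by simp
    then have "e c * transport_row I b e (unit_row c (e c)) (r # p) t \<ge> 0" if "t \<in> I" for t
      using that pm c unfolding u1 transport_row_mult by (auto simp del: transport_row.simps)
    moreover have "transport_row I b e (\<lambda>t. w u t + k * unit_row c (e c) t) (r # p) =
        (\<lambda>t. transport_row I b e (w u) (r # p) t + k * transport_row I b e (unit_row c (e c)) (r # p) t)" for u k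
      using transport_row_linear[of I b e 1 "w u" k "unit_row c (e c)" "r # p"] by (simp del: transport_row.simps)
    moreover have "transport_row I b e (\<lambda>t. - unit_row c (e c) t) (r # p) = (\<lambda>t. - transport_row I b e (unit_row c (e c)) (r # p) t)"
      using transport_row_mult[of I b e "-1" "unit_row c (e c)" "r # p"] by (simp del: transport_row.simps)
    ultimately show ?thesis
      using pm c by (intro bexI[of _ "e c"]) (auto simp: same simp del: transport_row.simps)
  next
    case idle
    have w1: "mutate_row I r b e (unit_row c x) = unit_row c x" for x
      using idle sumunit[of "\<lambda>k. max (e r * b r k) 0" x]
      by (intro ext) (auto simp: mutate_row_def unit_row_def)
    have hw: "mutate_row I r b h v = mutate_row I r b e v" for v
      using agree idle r by (intro ext) (simp add: mutate_row_def)
    have ec: "recolor r b e c = e c" using idle by (auto simp: recolor_def)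
    have hc': "recolor r b h c = - recolor r b e c"
      using idle agree r hc by (auto simp: recolor_def)
    have ag: "\<forall>t\<in>I. t \<noteq> c \<longrightarrow> recolor r b h t = recolor r b e t"
      using idle agree r by (auto simp: recolor_def)
    \<comment> \<open>As \<open>e r * b r c < 0\<close>, the change of column \<open>c\<close> has
      the same coefficients \<open>max (e r * b r t) 0\<close> as the change of the row, and the two
      cancel in the sum.\<close>
    have Z': "\<forall>u\<in>I - {c}. (\<Sum>t\<in>I. mutate_row I r b e (w u) t * mutate_matrix r b t c) = recolor r b e c * B u"
    proof
      fix u assume u: "u \<in> I - {c}"
      have er: "e r = 1 \<or> e r = -1" using pm r by auto
      have m: "mutate_matrix r b t c = b t c - max (e r * b r t) 0 * b c r" if "t \<noteq> r" for t
        using that idle er sk[of c r] sk[of t r] by (auto simp: mutate_matrix_def max_def)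
      have mr: "mutate_matrix r b r c = b c r" using sk[of r c] by (simp add: mutate_matrix_def)
      have "(\<Sum>t\<in>I. mutate_row I r b e (w u) t * mutate_matrix r b t c)
          = (- w u r + (\<Sum>k\<in>I. max (e r * b r k) 0 * w u k)) * b c r
            + (\<Sum>t\<in>I - {r}. w u t * (b t c - max (e r * b r t) 0 * b c r))"
        using fin r by (subst sum.remove[of _ r]) (simp_all add: mutate_row_def m mr)
      also have "(\<Sum>k\<in>I. max (e r * b r k) 0 * w u k) = (\<Sum>k\<in>I - {r}. max (e r * b r k) 0 * w u k)"
        using fin r fork_self[OF f, of r] by (subst sum.remove[of _ r]) simp_all
      also have "(- w u r + (\<Sum>k\<in>I - {r}. max (e r * b r k) 0 * w u k)) * b c r
            + (\<Sum>t\<in>I - {r}. w u t * (b t c - max (e r * b r t) 0 * b c r))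
          = w u r * b r c + (\<Sum>t\<in>I - {r}. w u t * b t c)"
        using sk[of c r] by (simp add: algebra_simps sum_distrib_left sum_distrib_right sum_subtractf sum_negf sum.distrib)
      also have "\<dots> = (\<Sum>t\<in>I. w u t * b t c)"
        using fin r by (subst (2) sum.remove[of _ r]) simp_all
      finally show "(\<Sum>t\<in>I. mutate_row I r b e (w u) t * mutate_matrix r b t c) = recolor r b e c * B u"
        using Z u ec by simp
    qed
    have lin: "mutate_row I r b e (\<lambda>t. w u t + k * unit_row c (e c) t) =
        (\<lambda>t. mutate_row I r b e (w u) t + k * unit_row c (e c) t)" for u k
      using mutate_row_linear[of I r b e 1 "w u" k "unit_row c (e c)"] by (simp add: w1)
    have neg: "mutate_row I r b e (\<lambda>t. - unit_row c (e c) t) = (\<lambda>t. - unit_row c (e c) t)"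
      using mutate_row_mult[of I r b e "-1" "unit_row c (e c)"] by (simp add: w1)
    show ?thesis
      using Cons.IH[OF f' p hcol' disjI1[OF ecol'] ag hc' Z']
      by (simp add: ec w1 hw lin neg)
  next
    case self
    have cP: "c \<notin> P" using r self by simp
    have ecol: "colored I P b e" using ecol cP by auto
    have skb: "skew b" using f by (simp add: fork_def)
    define d where "d = e c"
    have d: "d = 1 \<or> d = -1" using pm c d_def by auto
    have et: "recolor c b e t = e t" if "t \<in> I" "t \<noteq> c" for t
      using colored_neighbour[OF ecol hcol skb agree hc c cP that] that by (auto simp: recolor_def)
    have ht: "recolor c b h t = e t" if "t \<in> I" "t \<noteq> c" for t
      using colored_neighbour[OF hcol ecol skb _ _ c cP that] that agree hc by (auto simp: recolor_def)
    have ec: "recolor c b e c = - d" by (simp add: recolor_def d_def)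
    have hc': "recolor c b h c = d" using hc by (simp add: recolor_def d_def)
    have w1: "mutate_row I c b e (unit_row c x) = unit_row c (- x)" for x
      using sumunit[of "\<lambda>k. max (e c * b c k) 0" x]
      by (intro ext) (auto simp: mutate_row_def unit_row_def bcc)
    have w1h: "mutate_row I c b h (\<lambda>t. - unit_row c x t) = (\<lambda>t. - unit_row c (- x) t)" for x
      using mutate_row_mult[of I c b h "-1" "unit_row c x"] sumunit[of "\<lambda>k. max (h c * b c k) 0" x]
      by (intro ext) (auto simp: mutate_row_def unit_row_def bcc)
    have Z': "\<forall>u\<in>I - {c}. (\<Sum>t\<in>I. mutate_row I c b e (w u) t * mutate_matrix c b t c) = recolor c b e c * B u"
    proof
      fix u assume u: "u \<in> I - {c}"
      have "(\<Sum>t\<in>I. mutate_row I c b e (w u) t * mutate_matrix c b t c) = (\<Sum>t\<in>I. - (w u t * b t c))"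
        by (intro sum.cong) (auto simp: mutate_row_def mutate_matrix_def bcc)
      then show "(\<Sum>t\<in>I. mutate_row I c b e (w u) t * mutate_matrix c b t c) = recolor c b e c * B u"
        using Z u ec by (simp add: sum_negf d_def)
    qed
    \<comment> \<open>The two colourings use exchange sums of opposite sign at \<open>c\<close>. The
      difference of these sums is the pairing of the row with column \<open>c\<close>, known from
      the hypothesis on \<open>B\<close>; writing it as positive minus negative part turns the
      coefficient for \<open>d\<close> into the one for \<open>- d\<close>.\<close>
    have lin: "mutate_row I c b h (\<lambda>t. w u t + max (d * B u) 0 * unit_row c d t) =
        (\<lambda>t. mutate_row I c b e (w u) t + max (- d * B u) 0 * unit_row c (- d) t)" if u: "u \<in> I - {c}" for u
    proof
      fix t
      show "mutate_row I c b h (\<lambda>t. w u t + max (d * B u) 0 * unit_row c d t) t =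
        mutate_row I c b e (w u) t + max (- d * B u) 0 * unit_row c (- d) t"
      proof (cases "t = c")
        case True
        have "(\<Sum>k\<in>I. max (d * b c k) 0 * w u k) - (\<Sum>k\<in>I. max (- d * b c k) 0 * w u k)
            = (\<Sum>k\<in>I. - d * (w u k * b k c))"
          unfolding sum_subtractf[symmetric]
        proof (rule sum.cong)
          fix k
          have "max (d * b c k) 0 - max (- d * b c k) 0 = - d * b k c"
            using sk[of c k] by (auto simp: max_def)
          then have "(max (d * b c k) 0 - max (- d * b c k) 0) * w u k = - d * b k c * w u k" by simp
          then show "max (d * b c k) 0 * w u k - max (- d * b c k) 0 * w u k = - d * (w u k * b k c)"
            by (simp add: algebra_simps)
        qed simp
        also have "\<dots> = - d * (d * B u)" using Z u by (simp only: sum_distrib_left[symmetric] d_def) 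
        also have "\<dots> = - d * max (d * B u) 0 + d * max (- d * B u) 0"
          by (auto simp: max_def)
        finally have *: "(\<Sum>k\<in>I. max (d * b c k) 0 * w u k) - (\<Sum>k\<in>I. max (- d * b c k) 0 * w u k)
            = - d * max (d * B u) 0 + d * max (- d * B u) 0" .
        have "mutate_row I c b h (\<lambda>t. w u t + max (d * B u) 0 * unit_row c d t) c =
            - (w u c + max (d * B u) 0 * d) + ((\<Sum>k\<in>I. max (- d * b c k) 0 * w u k)
              + max (d * B u) 0 * (max (- d * b c c) 0 * d))"
          using sumunit[of "\<lambda>k. max (d * B u) 0 * max (- d * b c k) 0" d] hc d_def
          by (simp add: mutate_row_def unit_row_def distrib_left sum.distrib algebra_simps)
        moreover have "mutate_row I c b e (w u) c = - w u c + (\<Sum>k\<in>I. max (d * b c k) 0 * w u k)"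
          by (simp add: mutate_row_def d_def)
        ultimately show ?thesis using * True by (simp add: bcc unit_row_def algebra_simps)
      next
        case False
        then show ?thesis by (simp add: mutate_row_def unit_row_def)
      qed
    qed
    have ag: "\<forall>t\<in>I. t \<noteq> c \<longrightarrow> recolor c b h t = recolor c b e t" using et ht by simp
    have hcn: "recolor c b h c = - recolor c b e c" using ec hc' by simp
    show ?thesis
      using Cons.IH[OF f' p hcol' disjI1[OF ecol']] ag hcn Z'
      unfolding self by (simp add: ec w1 w1h lin d_def[symmetric])
  qed
qed

text \<open>From a constant colouring, the step at \<open>c\<close> changes the colour of
  \<open>c\<close> alone. So the walks along \<open>c # p\<close> and along \<open>p\<close> compare
  as in \<open>transport_row_connect\<close>, with column \<open>c\<close> of the mutated matrix as
  \<open>B\<close>.\<close>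

lemma transport_row_first_step:
  assumes fin: "finite I" and f: "fork I P b" and c: "c \<in> I" "c \<notin> P"
    and p: "set p \<subseteq> I" "distinct_adj (c # p)" and k: "k \<in> {1, -1}"
  shows "\<exists>d\<in>{1, -1}. (\<forall>t\<in>I. d * transport_row I (mutate_matrix c b) (\<lambda>_. k) (unit_row c k) p t \<ge> 0) \<and>
    (\<forall>u\<in>I. \<forall>t. transport_row I b (\<lambda>_. k) (unit_row u k) (c # p) t =
      (if u = c then - transport_row I (mutate_matrix c b) (\<lambda>_. k) (unit_row c k) p t
       else transport_row I (mutate_matrix c b) (\<lambda>_. k) (unit_row u k) p t
         + max (d * mutate_matrix c b u c) 0 * transport_row I (mutate_matrix c b) (\<lambda>_. k) (unit_row c k) p t))"
proof -
  let ?b = "mutate_matrix c b"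
  have f': "fork I {c} ?b" using fork_mutate_matrix[OF f c] .
  have p': "distinct_adj p" "p \<noteq> [] \<Longrightarrow> hd p \<notin> {c}" using p(2) by (cases p; auto)+
  have col: "colored I {c} ?b (recolor c b (\<lambda>_. k))" by (rule colored_recolor[OF f c]) (use k in auto)
  have sumunit: "(\<Sum>t\<in>I. g t * unit_row u x t) = g u * x" if "u \<in> I" for g u x
    using fin that by (simp add: unit_row_def if_distrib sum.delta cong: if_cong)
  have "(\<Sum>t\<in>I. unit_row u k t * ?b t c) = k * ?b u c" if "u \<in> I" for u
    using sumunit[of u "\<lambda>t. ?b t c" k] that by (simp add: mult.commute)
  then have Z: "\<forall>u\<in>I - {c}. (\<Sum>t\<in>I. unit_row u k t * ?b t c) = k * ?b u c" by auto
  have ws: "mutate_row I c b (\<lambda>_. k) (unit_row u k) = (\<lambda>t. unit_row u k t + max (k * ?b u c) 0 * unit_row c k t)"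
    if "u \<in> I - {c}" for u
    using that sumunit[of u "\<lambda>t. max (k * b c t) 0" k] fork_skew[OF f, of u c]
    by (intro ext) (auto simp: mutate_row_def unit_row_def mutate_matrix_def)
  have wc: "mutate_row I c b (\<lambda>_. k) (unit_row c k) = (\<lambda>t. - unit_row c k t)"
    using sumunit[of c "\<lambda>t. max (k * b c t) 0" k] c fork_self[OF f, of c]
    by (intro ext) (auto simp: mutate_row_def unit_row_def)
  have ex: "c \<in> {c} \<and> (\<exists>k'\<in>{1, -1}. \<forall>t\<in>I. k = k')" using k by auto
  have ag: "\<forall>t\<in>I. t \<noteq> c \<longrightarrow> recolor c b (\<lambda>_. k) t = k" by (simp add: recolor_def)
  have hc: "recolor c b (\<lambda>_. k) c = - k" by (simp add: recolor_def)
  from transport_row_connect[OF fin c(1) f' p(1) p' col disjI2[OF ex] ag hc Z]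
  obtain d where "d \<in> {1, -1}" "\<forall>t\<in>I. d * transport_row I ?b (\<lambda>_. k) (unit_row c k) p t \<ge> 0"
     "\<forall>u\<in>I - {c}. transport_row I ?b (recolor c b (\<lambda>_. k)) (\<lambda>t. unit_row u k t + max (k * ?b u c) 0 * unit_row c k t) p =
         (\<lambda>t. transport_row I ?b (\<lambda>_. k) (unit_row u k) p t + max (d * ?b u c) 0 * transport_row I ?b (\<lambda>_. k) (unit_row c k) p t)"
     "transport_row I ?b (recolor c b (\<lambda>_. k)) (\<lambda>t. - unit_row c k t) p = (\<lambda>t. - transport_row I ?b (\<lambda>_. k) (unit_row c k) p t)"
    by blast
  then show ?thesis by (intro bexI[of _ d]) (auto simp: ws wc)
qed

text \<open>\<open>pull_back\<close> performs the first step of the path last,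
  \<open>transport_row\<close> performs it first; \<open>transport_row_first_step\<close> reconciles
  the two. As row \<open>c\<close> has sign \<open>d\<close> and \<open>a\<close> is nonnegative,
  \<open>x c\<close> has sign \<open>d\<close>, where the piecewise linear
  \<open>mutate_column\<close> becomes linear.\<close>

theorem pull_back_eq_transport_row:
  assumes fin: "finite I" and k: "k \<in> {1, -1}" 
  shows "fork I P b \<Longrightarrow> set p \<subseteq> I \<Longrightarrow> distinct_adj p \<Longrightarrow> (p \<noteq> [] \<Longrightarrow> hd p \<notin> P) \<Longrightarrow> \<forall>t\<in>I. a t \<ge> 0 \<Longrightarrow>
    u \<in> I \<Longrightarrow>
    pull_back b p (\<lambda>t. k * a t) u = (\<Sum>t\<in>I. transport_row I b (\<lambda>_. k) (unit_row u k) p t * a t)"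
proof (induction p arbitrary: P b u)
  case Nil
  have "(\<Sum>t\<in>I. unit_row u k t * a t) = k * a u"
    using fin Nil.prems(6) by (simp add: unit_row_def if_distrib[where f="\<lambda>x. x * _"] sum.delta cong: if_cong)
  then show ?case by simp
next
  case (Cons c p)
  let ?b = "mutate_matrix c b"
  have c: "c \<in> I" "c \<notin> P" using Cons.prems by auto
  have p: "set p \<subseteq> I" "distinct_adj p" "p \<noteq> [] \<Longrightarrow> hd p \<notin> {c}"
    using Cons.prems(2,3) by (cases p; auto)+
  have f': "fork I {c} ?b" using fork_mutate_matrix[OF Cons.prems(1) c] .
  define W where "W u = transport_row I ?b (\<lambda>_. k) (unit_row u k) p" for u
  define x where "x = pull_back ?b p (\<lambda>t. k * a t)"
  have x: "x v = (\<Sum>t\<in>I. W v t * a t)" if "v \<in> I" for v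
    unfolding x_def W_def using Cons.IH[OF f' p Cons.prems(5) that] .
  obtain d where d: "d \<in> {1, -1}" and Wc: "\<forall>t\<in>I. d * W c t \<ge> 0" and
    R: "\<forall>u\<in>I. \<forall>t. transport_row I b (\<lambda>_. k) (unit_row u k) (c # p) t =
      (if u = c then - W c t else W u t + max (d * ?b u c) 0 * W c t)"
    using transport_row_first_step[OF fin Cons.prems(1) c p(1) Cons.prems(3) k] unfolding W_def by blast
  have "d * x c = (\<Sum>t\<in>I. d * W c t * a t)" using x[OF c(1)] by (simp add: sum_distrib_left mult.assoc)
  also have "\<dots> \<ge> 0" by (rule sum_nonneg, rule mult_nonneg_nonneg) (use Wc Cons.prems(5) in auto)
  finally have dx: "d * x c \<ge> 0" .
  have "(\<Sum>t\<in>I. transport_row I b (\<lambda>_. k) (unit_row u k) (c # p) t * a t)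
      = (if u = c then - x c else x u + max (d * ?b u c) 0 * x c)"
    using R Cons.prems(6) x c(1)
    by (simp del: transport_row.simps add: sum_negf distrib_right sum.distrib sum_distrib_left mult.assoc)
  also have "\<dots> = mutate_column c ?b x u"
  proof -
    have "max (d * ?b u c) 0 * x c = max (?b u c) 0 * max (x c) 0 - max (- ?b u c) 0 * max (- x c) 0"
      using d dx by (auto simp: max_def)
    then show ?thesis by (simp add: mutate_column_def)
  qed
  finally show ?case by (simp add: x_def)
qed

text \<open>The order of quantifiers is the point: one sign \<open>d\<close> serves all columns
  \<open>a\<close> at once, so the columns of all vertices of the other part agree in sign at
  \<open>c\<close>.\<close>

lemma pull_back_coherent:
  assumes fin: "finite I" and k: "k \<in> {1, -1}" and f: "fork I P b"
    and p: "set (c # p) \<subseteq> I" "distinct_adj (c # p)" "c \<notin> P"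
  shows "\<exists>d\<in>{1, -1}. \<forall>a. (\<forall>t\<in>I. a t \<ge> 0) \<longrightarrow> d * pull_back (mutate_matrix c b) p (\<lambda>t. k * a t) c \<ge> 0"
proof -
  have c: "c \<in> I" and p': "set p \<subseteq> I" "distinct_adj p" "p \<noteq> [] \<Longrightarrow> hd p \<notin> {c}"
    using p by (cases p; auto)+
  obtain d where d: "d \<in> {1, -1}" and Wc: "\<forall>t\<in>I. d * transport_row I (mutate_matrix c b) (\<lambda>_. k) (unit_row c k) p t \<ge> 0"
    using transport_row_first_step[OF fin f c p(3) p'(1) p(2) k] by blast
  show ?thesis
  proof (intro bexI[OF _ d] allI impI)
    fix a :: "'a \<Rightarrow> int" assume a: "\<forall>t\<in>I. a t \<ge> 0"
    have "d * pull_back (mutate_matrix c b) p (\<lambda>t. k * a t) c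
        = (\<Sum>t\<in>I. d * transport_row I (mutate_matrix c b) (\<lambda>_. k) (unit_row c k) p t * a t)"
      using pull_back_eq_transport_row[OF fin k fork_mutate_matrix[OF f c p(3)] p' a c]
      by (simp add: sum_distrib_left mult.assoc)
    also have "\<dots> \<ge> 0" by (rule sum_nonneg, rule mult_nonneg_nonneg) (use Wc a in auto)
    finally show "d * pull_back (mutate_matrix c b) p (\<lambda>t. k * a t) c \<ge> 0" .
  qed
qed

section \<open>Mutation of quivers and of joins\<close>

lemma is_quiverD:
  assumes "is_quiver Q"
  shows "finite (verts Q)" "arrows Q u v > 0 \<Longrightarrow> u \<in> verts Q" "arrows Q u v > 0 \<Longrightarrow> v \<in> verts Q"
    "arrows Q v v = 0" "arrows Q u v = 0 \<or> arrows Q v u = 0"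
  using assms by (simp_all add: is_quiver_def)

lemma verts_mutate [simp]: "verts (mutate i Q) = verts Q"
  by (simp add: mutate_def delete_2cycles_def reverse_at_def add_paths_def)

lemma skew_bmat: "skew (bmat Q)"
  by (simp add: skew_def bmat_def)

lemma arrows_eq_bmat:
  assumes "is_quiver Q"
  shows "arrows Q u v = nat (bmat Q u v)"
  using is_quiverD(5)[OF assms, of u v] by (auto simp: bmat_def)

lemma bmat_zero: "is_quiver Q \<Longrightarrow> u \<notin> verts Q \<or> v \<notin> verts Q \<Longrightarrow> bmat Q u v = 0"
  using is_quiverD(2,3)[of Q u v] is_quiverD(2,3)[of Q v u] by (fastforce simp: bmat_def)

lemma quiver_eqI:
  fixes Q Q' :: "'a quiver"
  assumes "is_quiver Q" "is_quiver Q'" "verts Q = verts Q'"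
    and "\<And>u v. u \<in> verts Q \<Longrightarrow> v \<in> verts Q \<Longrightarrow> bmat Q u v = bmat Q' u v"
  shows "Q = Q'"
proof -
  have "bmat Q u v = bmat Q' u v" for u v
    using assms bmat_zero[of Q u v] bmat_zero[of Q' u v] by (cases "u \<in> verts Q \<and> v \<in> verts Q") auto
  then have "arrows Q = arrows Q'"
    using arrows_eq_bmat[OF assms(1)] arrows_eq_bmat[OF assms(2)] by (intro ext) simp
  then show ?thesis using assms(3) by simp
qed

lemma arrows_mutate:
  "arrows (mutate i Q) u v =
    (let f = (\<lambda>u v. if u = i \<or> v = i then arrows Q v u + arrows Q v i * arrows Q i u
                    else arrows Q u v + arrows Q u i * arrows Q i v)
     in f u v - min (f u v) (f v u))"
  by (auto simp: mutate_def delete_2cycles_def reverse_at_def add_paths_def Let_def)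

lemma is_quiver_mutate:
  assumes "is_quiver Q"
  shows "is_quiver (mutate i Q)"
  unfolding is_quiver_def
proof (intro conjI allI impI)
  show "finite (verts (mutate i Q))" using is_quiverD(1)[OF assms] by simp
next
  fix u v assume "arrows (mutate i Q) u v > 0"
  then have "arrows Q u v > 0 \<or> arrows Q v u > 0 \<or> arrows Q u i * arrows Q i v > 0 \<or> arrows Q v i * arrows Q i u > 0"
    by (auto simp: arrows_mutate Let_def split: if_splits)
  then show "u \<in> verts (mutate i Q)" "v \<in> verts (mutate i Q)"
    using is_quiverD(2,3)[OF assms] by auto
next
  fix u v
  show "arrows (mutate i Q) v v = 0" by (simp add: arrows_mutate Let_def)
  show "arrows (mutate i Q) u v = 0 \<or> arrows (mutate i Q) v u = 0"
    by (auto simp: arrows_mutate Let_def min_def)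
qed

lemma bmat_mutate:
  assumes "is_quiver Q"
  shows "bmat (mutate i Q) = mutate_matrix i (bmat Q)"
proof (intro ext)
  fix u v
  have a: "int (arrows Q u v) = max (bmat Q u v) 0" for u v
    using arrows_eq_bmat[OF assms, of u v] by simp
  define f where "f = (\<lambda>u v. if u = i \<or> v = i then arrows Q v u + arrows Q v i * arrows Q i u
                    else arrows Q u v + arrows Q u i * arrows Q i v)"
  have "bmat (mutate i Q) u v = int (f u v) - int (f v u)"
    unfolding bmat_def arrows_mutate f_def[symmetric] Let_def by (simp add: min_def)
  also have "\<dots> = mutate_matrix i (bmat Q) u v"
  proof -
    have l: "arrows Q i i = 0" using is_quiverD(4)[OF assms] .
    have s: "bmat Q v i = - bmat Q i v" "bmat Q i u = - bmat Q u i" by (simp_all add: bmat_def)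
    have "bmat Q u v = int (arrows Q u v) - int (arrows Q v u)" by (simp add: bmat_def)
    then show ?thesis
      by (auto simp: f_def mutate_matrix_def l a s bmat_def[of Q i i] algebra_simps)
  qed
  finally show "bmat (mutate i Q) u v = mutate_matrix i (bmat Q) u v" .
qed

lemma mutate_mutate:
  assumes "is_quiver Q" shows "mutate i (mutate i Q) = Q"
  using assms by (intro quiver_eqI) (simp_all add: is_quiver_mutate bmat_mutate mutate_matrix_mutate_matrix)

lemma mutate_seq_simps [simp]:
  "mutate_seq [] Q = Q" "mutate_seq (i # p) Q = mutate_seq p (mutate i Q)"
  "mutate_seq (p @ q) Q = mutate_seq q (mutate_seq p Q)"
  by (simp_all add: mutate_seq_def)

definition mutate_matrix_seq :: "'a list \<Rightarrow> ('a \<Rightarrow> 'a \<Rightarrow> int) \<Rightarrow> 'a \<Rightarrow> 'a \<Rightarrow> int" where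
  "mutate_matrix_seq p b = fold mutate_matrix p b"

lemma mutate_matrix_seq_simps [simp]: "mutate_matrix_seq [] b = b" "mutate_matrix_seq (i # p) b = mutate_matrix_seq p (mutate_matrix i b)"
  "mutate_matrix_seq (p @ q) b = mutate_matrix_seq q (mutate_matrix_seq p b)"
  by (simp_all add: mutate_matrix_seq_def)

lemma mutate_seq_quiver:
  "is_quiver Q \<Longrightarrow> is_quiver (mutate_seq p Q) \<and> verts (mutate_seq p Q) = verts Q
    \<and> bmat (mutate_seq p Q) = mutate_matrix_seq p (bmat Q)"
  by (induction p arbitrary: Q) (simp_all add: is_quiver_mutate bmat_mutate)

lemma mutate_seq_rev:
  "is_quiver Q \<Longrightarrow> mutate_seq (rev p) (mutate_seq p Q) = Q"
  by (induction p arbitrary: Q) (simp_all add: is_quiver_mutate mutate_mutate)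

section \<open>Quivers split into a mutated and a fixed block\<close>

text \<open>
  \<open>x h t\<close> is the signed number of arrows from \<open>t \<in> I\<close> to \<open>h \<in> J\<close>.
\<close>

definition block_form ::
  "'a set \<Rightarrow> 'a set \<Rightarrow> 'a quiver \<Rightarrow> ('a \<Rightarrow> 'a \<Rightarrow> int) \<Rightarrow> ('a \<Rightarrow> 'a \<Rightarrow> int) \<Rightarrow> ('a \<Rightarrow> 'a \<Rightarrow> int) \<Rightarrow> bool" where
  "block_form I J Q b x g \<longleftrightarrow> is_quiver Q \<and> verts Q = I \<union> J \<and>
     (\<forall>u\<in>I. \<forall>v\<in>I. bmat Q u v = b u v) \<and> (\<forall>u\<in>J. \<forall>v\<in>J. bmat Q u v = g u v) \<and>
     (\<forall>h\<in>J. \<forall>t\<in>I. bmat Q t h = x h t)"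

lemma block_form_unique:
  assumes "block_form I J Q b x g" "block_form I J Q' b x' g" "\<forall>h\<in>J. \<forall>t\<in>I. x h t = x' h t"
  shows "Q = Q'"
proof (rule quiver_eqI)
  fix u v assume "u \<in> verts Q" "v \<in> verts Q"
  then have uv: "u \<in> I \<or> u \<in> J" "v \<in> I \<or> v \<in> J" using assms(1) by (auto simp: block_form_def)
  have "bmat Q t h = bmat Q' t h" if "t \<in> I" "h \<in> J" for t h using assms that by (simp add: block_form_def)
  moreover have "bmat Q h t = bmat Q' h t" if "t \<in> I" "h \<in> J" for t h
    using calculation[OF that] skewD[OF skew_bmat, of Q h t] skewD[OF skew_bmat, of Q' h t] by simp
  ultimately show "bmat Q u v = bmat Q' u v" using uv assms(1,2) by (auto simp: block_form_def)
qed (use assms in \<open>auto simp: block_form_def\<close>)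

text \<open>When all arrows between \<open>r\<close> and \<open>J\<close> point the same way, no
  path through \<open>r\<close> joins two vertices of \<open>J\<close>.\<close>

lemma block_form_mutate:
  assumes Q: "block_form I J Q b x g" and d: "I \<inter> J = {}" and r: "r \<in> I"
    and c: "e \<in> {1, -1}" "\<forall>h\<in>J. e * x h r \<ge> 0"
  shows "block_form I J (mutate r Q) (mutate_matrix r b) (\<lambda>h. mutate_column r b (x h)) g"
proof -
  have q: "is_quiver Q" using Q by (simp add: block_form_def)
  have rJ: "h \<noteq> r" if "h \<in> J" for h using that d r by auto
  have tJ: "h \<noteq> t" if "h \<in> J" "t \<in> I" for h t using that d by auto
  have hr: "bmat Q r h = x h r" "bmat Q h r = - x h r" if "h \<in> J" for h
    using Q that r skewD[OF skew_bmat, of Q h r] by (auto simp: block_form_def)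
  have "mutate_matrix r (bmat Q) u v = g u v" if "u \<in> J" "v \<in> J" for u v
  proof -
    have "e * x u r \<ge> 0" "e * x v r \<ge> 0" using c(2) that by auto
    then have "max (- x u r) 0 * max (x v r) 0 = max (x u r) 0 * max (- x v r) 0"
      using c(1) by auto
    then show ?thesis using Q that rJ hr by (simp add: mutate_matrix_def block_form_def)
  qed
  moreover have "mutate_matrix r (bmat Q) t h = mutate_column r b (x h) t" if "h \<in> J" "t \<in> I" for h t
    using Q that rJ hr r by (auto simp: mutate_matrix_def mutate_column_def block_form_def)
  ultimately show ?thesis
    using Q r by (simp add: block_form_def is_quiver_mutate bmat_mutate) (simp add: mutate_matrix_def)
qed

lemma fork_mutate_matrix_seq:
  "fork I P b \<Longrightarrow> set p \<subseteq> I \<Longrightarrow> distinct_adj (p @ q) \<Longrightarrow> (p @ q \<noteq> [] \<Longrightarrow> hd (p @ q) \<notin> P) \<Longrightarrow>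
    \<exists>P'. fork I P' (mutate_matrix_seq p b) \<and> (q \<noteq> [] \<longrightarrow> hd q \<notin> P')"
proof (induction p arbitrary: P b)
  case (Cons r p)
  have r: "r \<in> I" "r \<notin> P" using Cons.prems by auto
  have "p @ q \<noteq> [] \<Longrightarrow> hd (p @ q) \<notin> {r}" "distinct_adj (p @ q)"
    using Cons.prems(3) by (auto simp: distinct_adj_Cons)
  then show ?case using Cons.IH[OF fork_mutate_matrix[OF Cons.prems(1) r]] Cons.prems(2) by simp
qed auto

lemma block_form_pull_back:
  assumes fin: "finite I" and d: "I \<inter> J = {}" and k: "k \<in> {1, -1}"
    and a: "\<forall>h\<in>J. \<forall>t\<in>I. a h t \<ge> 0"
  shows "fork I P b \<Longrightarrow> set p \<subseteq> I \<Longrightarrow> distinct_adj p \<Longrightarrow> (p \<noteq> [] \<Longrightarrow> hd p \<notin> P) \<Longrightarrow>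
    block_form I J Q (mutate_matrix_seq p b) (\<lambda>h t. k * a h t) g \<Longrightarrow>
    block_form I J (mutate_seq (rev p) Q) b (\<lambda>h. pull_back b p (\<lambda>t. k * a h t)) g"
proof (induction p arbitrary: P b)
  case (Cons c p)
  have c: "c \<in> I" "c \<notin> P" using Cons.prems by auto
  have p: "set p \<subseteq> I" "distinct_adj p" "p \<noteq> [] \<Longrightarrow> hd p \<notin> {c}"
    using Cons.prems(2,3) by (cases p; auto)+
  have IH: "block_form I J (mutate_seq (rev p) Q) (mutate_matrix c b) (\<lambda>h. pull_back (mutate_matrix c b) p (\<lambda>t. k * a h t)) g"
    using Cons.IH[OF fork_mutate_matrix[OF Cons.prems(1) c] p] Cons.prems(5) by simp
  obtain e where e: "e \<in> {1, -1}"
     "\<forall>a. (\<forall>t\<in>I. a t \<ge> 0) \<longrightarrow> e * pull_back (mutate_matrix c b) p (\<lambda>t. k * a t) c \<ge> 0"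
    using pull_back_coherent[OF fin k Cons.prems(1-3) c(2)] by blast
  have "\<forall>h\<in>J. e * pull_back (mutate_matrix c b) p (\<lambda>t. k * a h t) c \<ge> 0"
  proof
    fix h assume "h \<in> J"
    then show "e * pull_back (mutate_matrix c b) p (\<lambda>t. k * a h t) c \<ge> 0" using e(2)[rule_format, of "a h"] a by blast
  qed
  from block_form_mutate[OF IH d c(1) e(1) this] show ?case
    by (simp add: mutate_matrix_mutate_matrix)
qed simp

lemma is_quiver_join:
  assumes "is_quiver X" "is_quiver Y" "verts X \<inter> verts Y = {}"
  shows "is_quiver (join_quiver X B Y)"
  unfolding is_quiver_def
proof (intro conjI allI impI)
  show "finite (verts (join_quiver X B Y))"
    using is_quiverD(1)[OF assms(1)] is_quiverD(1)[OF assms(2)] by (simp add: join_quiver_def)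
next
  fix u v
  show "arrows (join_quiver X B Y) u v > 0 \<Longrightarrow> u \<in> verts (join_quiver X B Y)"
    "arrows (join_quiver X B Y) u v > 0 \<Longrightarrow> v \<in> verts (join_quiver X B Y)"
    by (auto simp: join_quiver_def split: if_splits)
  show "arrows (join_quiver X B Y) v v = 0"
    using is_quiverD(4)[OF assms(1)] is_quiverD(4)[OF assms(2)] assms(3) by (auto simp: join_quiver_def)
  show "arrows (join_quiver X B Y) u v = 0 \<or> arrows (join_quiver X B Y) v u = 0"
    using is_quiverD(5)[OF assms(1)] is_quiverD(5)[OF assms(2)] assms(3) by (auto simp: join_quiver_def)
qed


section \<open>Source sequences\<close>

definition flip_sign :: "'a set \<Rightarrow> 'a \<Rightarrow> int" where
  "flip_sign D t = (if t \<in> D then -1 else 1)"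

text \<open>Conjugation by signs reverses the arrows between \<open>D\<close> and its complement.
  This is the effect of mutating once at each vertex of \<open>D\<close>, each time at a
  sink.\<close>

definition flip_matrix :: "'a set \<Rightarrow> ('a \<Rightarrow> 'a \<Rightarrow> int) \<Rightarrow> 'a \<Rightarrow> 'a \<Rightarrow> int" where
  "flip_matrix D b i j = flip_sign D i * flip_sign D j * b i j"

text \<open>The sign conditions make \<open>r\<close> a sink of \<open>flip_matrix D b\<close>. So
  no path runs through \<open>r\<close>, and a green sink has no heads to recolour or to sum
  over.\<close>

lemma flip_matrix_sink:
  assumes sk: "skew b" and r: "r \<notin> D"
    and s: "\<forall>t. t \<notin> D \<longrightarrow> b r t \<le> 0" "\<forall>t\<in>D. b r t \<ge> 0"
  shows "mutate_matrix r (flip_matrix D b) = flip_matrix (insert r D) b"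
    and "recolor r (flip_matrix D b) (flip_sign D) = flip_sign (insert r D)"
    and "mutate_row I r (flip_matrix D b) (flip_sign D) (unit_row u (flip_sign D u)) = unit_row u (flip_sign (insert r D) u)"
proof -
  have le: "flip_matrix D b r t \<le> 0" for t using s r by (auto simp: flip_matrix_def flip_sign_def)
  have ge: "flip_matrix D b t r \<ge> 0" for t 
    using le[of t] skewD[OF sk, of t r] by (simp add: flip_matrix_def mult.commute)
  show "mutate_matrix r (flip_matrix D b) = flip_matrix (insert r D) b"
  proof (intro ext)
    fix i j
    have "max (flip_matrix D b r j) 0 = 0" "max (- flip_matrix D b i r) 0 = 0" using le[of j] ge[of i] by auto
    then show "mutate_matrix r (flip_matrix D b) i j = flip_matrix (insert r D) b i j"
      using r skew_self[OF sk, of r] by (auto simp: mutate_matrix_def flip_matrix_def flip_sign_def)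
  qed
  have nn: "\<not> flip_sign D r * flip_matrix D b r t > 0" for t using le[of t] r by (simp add: flip_sign_def)
  show "recolor r (flip_matrix D b) (flip_sign D) = flip_sign (insert r D)"
    using nn r by (intro ext) (auto simp: recolor_def flip_sign_def)
  have "max (flip_sign D r * flip_matrix D b r k) 0 = 0" for k using nn[of k] by simp
  then show "mutate_row I r (flip_matrix D b) (flip_sign D) (unit_row u (flip_sign D u)) = unit_row u (flip_sign (insert r D) u)"
    using r by (intro ext) (simp add: mutate_row_def unit_row_def flip_sign_def)
qed

text \<open>\<open>D\<close> collects the vertices mutated so far, and the order of \<open>L\<close>
  makes its next vertex a sink. When \<open>D\<close> has reached \<open>I\<close>, green has become
  red everywhere and each unit row has changed its sign.\<close>

lemma transport_row_sinks:
  assumes sk: "skew b" and z: "\<And>u v. v \<notin> I \<Longrightarrow> b u v = 0"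
  shows "distinct L \<Longrightarrow> set L \<inter> D = {} \<Longrightarrow> D \<union> set L = I \<Longrightarrow> sorted_wrt (\<lambda>u v. b u v \<le> 0) L \<Longrightarrow>
    \<forall>t\<in>D. \<forall>r\<in>set L. b t r \<le> 0 \<Longrightarrow>
    transport_row I (flip_matrix D b) (flip_sign D) (unit_row u (flip_sign D u)) (L @ M) = transport_row I (flip_matrix I b) (flip_sign I) (unit_row u (flip_sign I u)) M
    \<and> (\<forall>k\<le>length L. mutate_matrix_seq (take k L) (flip_matrix D b) = flip_matrix (D \<union> set (take k L)) b)"
proof (induction L arbitrary: D)
  case (Cons r L)
  have r: "r \<notin> D" using Cons.prems by auto
  have s2: "\<forall>t\<in>D. b r t \<ge> 0"
  proof
    fix t assume "t \<in> D"
    then have "b t r \<le> 0" using Cons.prems by auto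
    then show "b r t \<ge> 0" using skewD[OF sk, of r t] by simp
  qed
  have s1: "\<forall>t. t \<notin> D \<longrightarrow> b r t \<le> 0"
  proof (intro allI impI)
    fix t assume t: "t \<notin> D"
    show "b r t \<le> 0"
    proof (cases "t \<in> I")
      case True
      then have "t = r \<or> t \<in> set L" using t Cons.prems(3) by auto
      then show ?thesis using Cons.prems(4) skew_self[OF sk, of r] by auto
    qed (use z in simp)
  qed
  note fs = flip_matrix_sink[OF sk r s1 s2]
  have IH: "transport_row I (flip_matrix (insert r D) b) (flip_sign (insert r D)) (unit_row u (flip_sign (insert r D) u)) (L @ M)
       = transport_row I (flip_matrix I b) (flip_sign I) (unit_row u (flip_sign I u)) M
    \<and> (\<forall>k\<le>length L. mutate_matrix_seq (take k L) (flip_matrix (insert r D) b) = flip_matrix (insert r D \<union> set (take k L)) b)"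
    using Cons.prems by (intro Cons.IH) auto
  show ?case
  proof (intro conjI allI impI)
    show "transport_row I (flip_matrix D b) (flip_sign D) (unit_row u (flip_sign D u)) ((r # L) @ M) = transport_row I (flip_matrix I b) (flip_sign I) (unit_row u (flip_sign I u)) M"
      using IH fs by simp
    fix k assume "k \<le> length (r # L)"
    then show "mutate_matrix_seq (take k (r # L)) (flip_matrix D b) = flip_matrix (D \<union> set (take k (r # L))) b"
      using IH fs by (cases k) auto
  qed
qed simp

text \<open>After \<open>L\<close> all signs in \<open>flip_matrix I b\<close> cancel, so the walk
  is back at \<open>b\<close>, with the all-red colouring. From there it coincides with the walk
  along \<open>M\<close> that starts red, which computes the pull-back of the negated
  column.\<close>

lemma pull_back_sinks:
  assumes fin: "finite I" and f: "fork I {} b" and z: "\<And>u v. v \<notin> I \<Longrightarrow> b u v = 0"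
    and L: "distinct L" "set L = I" "sorted_wrt (\<lambda>u v. b u v \<le> 0) L"
    and M: "set M \<subseteq> I" "distinct_adj (L @ M)" and a: "\<forall>t\<in>I. a t \<ge> 0" and u: "u \<in> I"
  shows "pull_back b (L @ M) a u = pull_back b M (\<lambda>t. - a t) u"
proof -
  have sk: "skew b" using f by (simp add: fork_def)
  have z2: "b u v = 0" if "u \<notin> I" for u v using z[OF that] skewD[OF sk, of u v] by simp
  have e: "flip_matrix {} b = b" "flip_sign {} = (\<lambda>_. 1)" by (intro ext, simp add: flip_matrix_def flip_sign_def)+
  have eI: "flip_matrix I b = b"
    by (intro ext) (auto simp: flip_matrix_def flip_sign_def z z2)
  have "transport_row I b (\<lambda>_. 1) (unit_row v 1) (L @ M) = transport_row I b (flip_sign I) (unit_row v (flip_sign I v)) M" for v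
  proof -
    have "transport_row I (flip_matrix {} b) (flip_sign {}) (unit_row v (flip_sign {} v)) (L @ M) = transport_row I (flip_matrix I b) (flip_sign I) (unit_row v (flip_sign I v)) M"
      using transport_row_sinks[OF sk z, where I=I and D="{}" and L=L and u=v and M=M] L by simp
    then show ?thesis unfolding e eI .
  qed
  also have "\<dots> v = transport_row I b (\<lambda>_. -1) (unit_row v (-1)) M" if "v \<in> I" for v
    using transport_row_cong[OF M(1), of "flip_sign I" "\<lambda>_. -1" b] that by (simp add: flip_sign_def)
  finally have R: "transport_row I b (\<lambda>_. 1) (unit_row v 1) (L @ M) = transport_row I b (\<lambda>_. -1) (unit_row v (-1)) M" if "v \<in> I" for v
    using that .
  have "pull_back b (L @ M) (\<lambda>t. 1 * a t) u = (\<Sum>t\<in>I. transport_row I b (\<lambda>_. 1) (unit_row u 1) (L @ M) t * a t)"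
    using L M by (intro pull_back_eq_transport_row[OF fin _ f _ _ _ a u]) auto
  also have "\<dots> = (\<Sum>t\<in>I. transport_row I b (\<lambda>_. -1) (unit_row u (-1)) M t * a t)" using R[OF u] by simp
  also have "\<dots> = pull_back b M (\<lambda>t. -1 * a t) u"
    using M by (intro pull_back_eq_transport_row[OF fin _ f _ _ _ a u, symmetric]) (auto simp: distinct_adj_append_iff)
  finally show ?thesis by simp
qed

section \<open>Growth of the number of arrows along a path\<close>

definition total_weight :: "'a set \<Rightarrow> ('a \<Rightarrow> 'a \<Rightarrow> int) \<Rightarrow> int" where
  "total_weight I b = (\<Sum>(i, j)\<in>I \<times> I. \<bar>b i j\<bar>)"

definition passes_through :: "'a set \<Rightarrow> ('a \<Rightarrow> 'a \<Rightarrow> int) \<Rightarrow> 'a \<Rightarrow> bool" where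
  "passes_through I b r \<longleftrightarrow> (\<exists>i\<in>I. \<exists>j\<in>I. b i r > 0 \<and> b r j > 0)"

lemma total_weight_mutate_matrix:
  assumes fin: "finite I" and f: "fork I P b" and r: "r \<in> I" "r \<notin> P" and t: "passes_through I b r"
  shows "total_weight I (mutate_matrix r b) > total_weight I b"
proof -
  have sk: "skew b" using f by (simp add: fork_def)
  obtain i j where ij: "i \<in> I" "j \<in> I" "b i r > 0" "b r j > 0" using t by (auto simp: passes_through_def)
  have str: "\<bar>mutate_matrix r b u v\<bar> > \<bar>b u v\<bar>" if "u \<in> I" "v \<in> I" "b u r > 0" "b r v > 0" for u v
    using mutate_matrix_path(4)[OF f r that] .
  have "\<bar>mutate_matrix r b u v\<bar> \<ge> \<bar>b u v\<bar>" if uv: "u \<in> I" "v \<in> I" for u v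
  proof (cases "u = r \<or> v = r")
    case False
    have "\<bar>mutate_matrix r b v u\<bar> = \<bar>mutate_matrix r b u v\<bar>" "\<bar>b v u\<bar> = \<bar>b u v\<bar>"
      using skewD[OF sk, of v u] skewD[OF skew_mutate_matrix[OF sk], of r v u] by auto
    then show ?thesis
      using mutate_matrix_no_path[OF f, of u r v] False str[of u v] str[of v u] uv by fastforce
  qed (auto simp: mutate_matrix_def)
  moreover have "\<bar>mutate_matrix r b i j\<bar> > \<bar>b i j\<bar>" using str ij by blast
  ultimately show ?thesis
    unfolding total_weight_def using fin ij(1,2)
    by (intro sum_strict_mono_ex1) auto
qed

text \<open>The new point of return \<open>r\<close> has arrows in both directions, so any arrow
  between \<open>v\<close> and \<open>r\<close> extends to a path through \<open>r\<close>. The fork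
  inequality closes this path to an oriented triangle, and \<open>v\<close> lies on it.\<close>

lemma passes_through_mutate_matrix:
  assumes f: "fork I P b" and r: "r \<in> I" "r \<notin> P" and t: "passes_through I b r" and v: "v \<in> I"
  shows "passes_through I (mutate_matrix r b) v"
proof -
  have f': "fork I {r} (mutate_matrix r b)" using fork_mutate_matrix[OF f r] .
  obtain i j where ij: "i \<in> I" "j \<in> I" "b i r > 0" "b r j > 0" using t by (auto simp: passes_through_def)
  then have p: "mutate_matrix r b j r > 0" "mutate_matrix r b r i > 0"
    using fork_skew[OF f, of r i] fork_skew[OF f, of j r] by (auto simp: mutate_matrix_def)
  show ?thesis
  proof (cases "v = r")
    case True
    then show ?thesis using p ij by (auto simp: passes_through_def)
  next
    case False
    then consider "mutate_matrix r b v r > 0" | "mutate_matrix r b r v > 0" using fork_nz[OF f' v r(1)] by blast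
    then show ?thesis
    proof cases
      case 1
      then have "mutate_matrix r b i v > 0" using fork_return[OF f', of r v i] v ij p by auto
      then show ?thesis using 1 ij r by (auto simp: passes_through_def)
    next
      case 2
      then have "mutate_matrix r b v j > 0" using fork_return[OF f', of r j v] v ij p by auto
      then show ?thesis using 2 ij r by (auto simp: passes_through_def)
    qed
  qed
qed

lemma total_weight_mutate_matrix_seq:
  assumes fin: "finite I"
  shows "fork I P b \<Longrightarrow> set p \<subseteq> I \<Longrightarrow> distinct_adj p \<Longrightarrow> (p \<noteq> [] \<Longrightarrow> hd p \<notin> P) \<Longrightarrow>
    (p \<noteq> [] \<Longrightarrow> passes_through I b (hd p)) \<Longrightarrow> k \<le> length p \<Longrightarrow> j < k \<Longrightarrow>
    total_weight I (mutate_matrix_seq (take j p) b) < total_weight I (mutate_matrix_seq (take k p) b)"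
proof (induction p arbitrary: P b j k)
  case (Cons r p)
  have r: "r \<in> I" "r \<notin> P" and t: "passes_through I b r" using Cons.prems by auto
  have p: "set p \<subseteq> I" "distinct_adj p" "p \<noteq> [] \<Longrightarrow> hd p \<notin> {r}"
    using Cons.prems(2,3) by (cases p; auto)+
  have t': "p \<noteq> [] \<Longrightarrow> passes_through I (mutate_matrix r b) (hd p)"
    using passes_through_mutate_matrix[OF Cons.prems(1) r t, of "hd p"] p(1) by (cases p) auto
  note IH = Cons.IH[OF fork_mutate_matrix[OF Cons.prems(1) r] p t']
  obtain k' where k': "k = Suc k'" using Cons.prems(7) by (cases k) auto
  show ?case
  proof (cases j)
    case 0
    have "total_weight I (mutate_matrix r b) \<le> total_weight I (mutate_matrix_seq (take k' p) (mutate_matrix r b))"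
      using IH[of k' 0] Cons.prems(6) k' by (cases k') auto
    then show ?thesis using 0 k' total_weight_mutate_matrix[OF fin Cons.prems(1) r t] by simp
  next
    case (Suc j')
    then show ?thesis using IH[of k' j'] Cons.prems(6,7) k' by simp
  qed
qed simp

lemma total_weight_flip_matrix: "total_weight I (flip_matrix D b) = total_weight I b"
  unfolding total_weight_def by (intro sum.cong) (auto simp: flip_matrix_def flip_sign_def)

section \<open>Reddening source sequences of abundant acyclic quivers\<close>

lemma source_sequence_sorted:
  assumes "is_quiver T" "source_sequence T S"
  shows "sorted_wrt (\<lambda>u v. bmat T u v \<ge> 0) S"
  unfolding sorted_wrt_iff_nth_less
proof (intro allI impI)
  fix i j assume ij: "i < j" "j < length S"
  then have "\<not> arrows T (S ! j) (S ! i) > 0" using assms(2) unfolding source_sequence_def by (meson less_asym less_trans)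
  then show "bmat T (S ! i) (S ! j) \<ge> 0" by (simp add: bmat_def)
qed

text \<open>Between two occurrences of a vertex stands a different one, joined to it by abundance;
  these arrows would have to respect the order with respect to both occurrences.\<close>

lemma source_sequence_distinct:
  assumes q: "is_quiver T" and ab: "abundant T" and s: "source_sequence T S" and d: "distinct_adj S"
  shows "distinct S"
proof (rule ccontr)
  assume "\<not> distinct S"
  then obtain i j where ij: "i < length S" "j < length S" "i < j" "S ! i = S ! j"
    unfolding distinct_conv_nth by (metis nat_neq_iff)
  have "S ! i \<noteq> S ! Suc i" using d ij by (auto simp: distinct_adj_conv_nth)
  then have n: "Suc i < j" using ij by (metis Suc_lessI)
  have "set S \<subseteq> verts T" using s by (simp add: source_sequence_def)
  then have "S ! i \<in> verts T" "S ! Suc i \<in> verts T" using ij n by (meson less_trans nth_mem subsetD)+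
  then have "\<bar>bmat T (S ! i) (S ! Suc i)\<bar> \<ge> 2"
    using ab \<open>S ! i \<noteq> S ! Suc i\<close> unfolding abundant_def by blast
  moreover have "bmat T (S ! i) (S ! Suc i) \<ge> 0" "bmat T (S ! Suc i) (S ! j) \<ge> 0"
    using source_sequence_sorted[OF q s] ij(1-3) n unfolding sorted_wrt_iff_nth_less by auto
  ultimately show False using ij skewD[OF skew_bmat, of T "S ! i" "S ! Suc i"] by simp
qed

lemma is_quiver_framed:
  assumes "is_quiver Q"
  shows "is_quiver (framed Q)"
  unfolding is_quiver_def
proof (intro conjI allI impI)
  show "finite (verts (framed Q))" using is_quiverD(1)[OF assms] by (simp add: framed_def)
next
  fix u v assume "arrows (framed Q) u v > 0"
  then show "u \<in> verts (framed Q)" "v \<in> verts (framed Q)"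
    using is_quiverD(2,3)[OF assms] by (auto simp: framed_def split: fvert.splits if_splits)
next
  fix u v
  show "arrows (framed Q) v v = 0" using is_quiverD(4)[OF assms] by (simp add: framed_def split: fvert.splits)
  show "arrows (framed Q) u v = 0 \<or> arrows (framed Q) v u = 0"
    using is_quiverD(5)[OF assms] by (simp add: framed_def split: fvert.splits)
qed

lemma mutate_matrix_seq_framed_unmutated:
  assumes "j \<notin> set p"
  shows "\<forall>k. b (Mutable k) (Frozen j) = (if k = j then 1 else 0) \<Longrightarrow>
    mutate_matrix_seq (map Mutable p) b (Mutable k) (Frozen j) = (if k = j then 1 else 0)"
  using assms
proof (induction p arbitrary: b)
  case (Cons r p)
  then have "\<forall>k. mutate_matrix (Mutable r) b (Mutable k) (Frozen j) = (if k = j then 1 else 0)"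
    by (auto simp: mutate_matrix_def)
  then show ?case using Cons by simp
qed simp

lemma reddening_all_verts:
  assumes "is_quiver T" "reddening T S"
  shows "set S = verts T"
proof
  show "set S \<subseteq> verts T" using assms(2) by (simp add: reddening_def)
  show "verts T \<subseteq> set S"
  proof
    fix j assume j: "j \<in> verts T"
    show "j \<in> set S"
    proof (rule ccontr)
      assume n: "j \<notin> set S"
      have "\<forall>k. bmat (framed T) (Mutable k) (Frozen j) = (if k = j then 1 else 0)"
        using j by (auto simp: bmat_def framed_def)
      then have "mutate_matrix_seq (map Mutable S) (bmat (framed T)) (Mutable j) (Frozen j) = 1"
        using mutate_matrix_seq_framed_unmutated[OF n] by auto
      then have "bmat (mutate_seq (map Mutable S) (framed T)) (Mutable j) (Frozen j) = 1"
        using mutate_seq_quiver[OF is_quiver_framed[OF assms(1)]] by metis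
      then show False using assms(2) j unfolding reddening_def by force
    qed
  qed
qed

text \<open>Abundance joins any two vertices, so acyclicity leaves only a transitive
  tournament.\<close>

lemma fork_acyclic:
  assumes q: "is_quiver T" and ab: "abundant T" and ac: "acyclic_quiver T"
  shows "fork (verts T) {} (bmat T)"
  unfolding fork_def
proof (intro conjI ballI impI)
  fix i j k assume ijk: "i \<in> verts T - {}" "j \<in> verts T - {}" "k \<in> verts T - {}"
    and p: "bmat T i j > 0" "bmat T j k > 0"
  let ?R = "{(u, v). arrows T u v > 0}"
  have R: "(u, v) \<in> ?R" if "bmat T u v > 0" for u v
    using that arrows_eq_bmat[OF q, of u v] by simp
  have ac: "acyclic ?R" using ac by (simp add: acyclic_quiver_def)
  show "bmat T i k > 0"
  proof (rule ccontr)
    assume n: "\<not> ?thesis"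
    have ij: "(i, j) \<in> ?R" "(j, k) \<in> ?R" using R p by auto
    have "i \<noteq> k" using p skewD[OF skew_bmat, of T i j] by auto
    then have "\<bar>bmat T i k\<bar> \<ge> 2" using ab ijk by (simp add: abundant_def)
    then have "bmat T k i > 0" using n skewD[OF skew_bmat, of T i k] by simp
    then have "(i, i) \<in> ?R\<^sup>+" using ij R by (meson trancl.simps)
    then show False using ac by (simp add: acyclic_def)
  qed
qed (use ab in \<open>auto simp: skew_bmat abundant_def\<close>)

section \<open>One half of the cycle\<close>

context
  fixes T G :: "'a quiver" and S M :: "'a list" and A :: "'a \<Rightarrow> 'a \<Rightarrow> nat"
  assumes q: "is_quiver T" and ab: "abundant T" and ac: "acyclic_quiver T"
    and rss: "reddening_source_sequence T S" and M: "set M \<subseteq> verts T"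
    and adj: "distinct_adj (rev M @ S @ M)"
    and G: "is_quiver G" and disj: "verts T \<inter> verts G = {}"
begin

abbreviation (input) "mat \<equiv> bmat T"
text \<open>Seen from \<open>T\<close>, both \<open>route\<close> and \<open>M\<close> lead outwards
  to \<open>T_mut\<close>; \<open>half\<close> comes back along \<open>route\<close> and leaves
  along \<open>M\<close>.\<close>

abbreviation (input) "route \<equiv> rev S @ M"
abbreviation (input) "T_mut \<equiv> mutate_seq M T"
abbreviation (input) "join_in \<equiv> join_quiver T_mut A G"
abbreviation (input) "join_out \<equiv> join_quiver G (\<lambda>h t. A t h) T_mut"
abbreviation (input) "half \<equiv> rev M @ S @ M"

lemma finite_T: "finite (verts T)"
  using is_quiverD(1)[OF q] .

lemma fork_T: "fork (verts T) {} mat"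
  by (rule fork_acyclic[OF q ab ac])

lemma set_S: "set S = verts T"
  using reddening_all_verts[OF q] rss by (simp add: reddening_source_sequence_def)

lemma sorted_S: "sorted_wrt (\<lambda>u v. mat u v \<ge> 0) S"
  using source_sequence_sorted[OF q] rss by (simp add: reddening_source_sequence_def)

lemma distinct_S: "distinct S"
  using source_sequence_distinct[OF q ab] rss adj
  by (auto simp: reddening_source_sequence_def distinct_adj_append_iff)

lemma sorted_rev_S: "sorted_wrt (\<lambda>u v. mat u v \<le> 0) (rev S)"
  unfolding sorted_wrt_rev
  by (rule sorted_wrt_mono_rel[OF _ sorted_S]) (use skewD[OF skew_bmat] in \<open>metis neg_le_0_iff_le\<close>)

text \<open>Read off from the two junctions of the reduced word \<open>half\<close>. One inequality
  makes \<open>route\<close> reduced; together they keep \<open>hd M\<close> away from the source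
  and the sink of \<open>T\<close>.\<close>

lemma hd_M: "M \<noteq> [] \<Longrightarrow> S \<noteq> [] \<and> hd M \<noteq> hd S \<and> hd M \<noteq> last S"
proof -
  assume m: "M \<noteq> []"
  then have s: "S \<noteq> []" using set_S M by (cases M) auto
  then show ?thesis using adj m by (auto simp: distinct_adj_append_iff last_rev)
qed

lemma adj_p: "distinct_adj route"
  using adj hd_M by (auto simp: distinct_adj_append_iff last_rev)

lemma set_p: "set route \<subseteq> verts T"
  using set_S M by auto

lemma mutate_matrix_seq_S: "k \<le> length S \<Longrightarrow> mutate_matrix_seq (take k (rev S)) mat = flip_matrix (set (take k (rev S))) mat"
proof -
  assume k: "k \<le> length S"
  have e: "flip_matrix {} mat = mat" by (intro ext) (simp add: flip_matrix_def flip_sign_def)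
  show ?thesis
    using transport_row_sinks[OF skew_bmat, of "verts T" T "rev S" "{}"] bmat_zero[OF q] distinct_S set_S
      sorted_rev_S k e by simp
qed

lemma mutate_matrix_seq_rev_S: "mutate_matrix_seq (rev S) mat = mat"
proof -
  have "flip_matrix (verts T) mat = mat"
    by (intro ext) (auto simp: flip_matrix_def flip_sign_def bmat_zero[OF q])
  then show ?thesis using mutate_matrix_seq_S[of "length S"] set_S by simp
qed

text \<open>The sequence lists all vertices from the source \<open>hd S\<close> to the sink
  \<open>last S\<close>, and \<open>hd M\<close> stands strictly between them.\<close>

lemma passes_through_hd_M:
  assumes "M \<noteq> []" shows "passes_through (verts T) mat (hd M)"
proof -
  have S: "S \<noteq> []" "hd M \<noteq> hd S" "hd M \<noteq> last S" using hd_M[OF assms] by auto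
  have "hd M \<in> set S" using assms M set_S by (cases M) auto
  then obtain k where k: "k < length S" "S ! k = hd M" by (auto simp: in_set_conv_nth)
  have "0 < k" using S k by (cases k) (auto simp: hd_conv_nth)
  moreover have "k < length S - 1" using S k by (cases "k = length S - 1") (auto simp: last_conv_nth)
  ultimately have "mat (hd S) (hd M) \<ge> 0" "mat (hd M) (last S) \<ge> 0"
    using sorted_S[unfolded sorted_wrt_iff_nth_less, rule_format, of 0 k]
      sorted_S[unfolded sorted_wrt_iff_nth_less, rule_format, of k "length S - 1"] k S
    by (simp_all add: hd_conv_nth last_conv_nth)
  moreover have mem: "hd S \<in> verts T" "last S \<in> verts T" "hd M \<in> verts T"
    using S(1) \<open>hd M \<in> set S\<close> hd_in_set[of S] last_in_set[of S] unfolding set_S by blast+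
  ultimately have "mat (hd S) (hd M) > 0" "mat (hd M) (last S) > 0"
    using fork_abundant[OF fork_T, of "hd S" "hd M"] fork_abundant[OF fork_T, of "hd M" "last S"] S
    by fastforce+
  with mem show ?thesis unfolding passes_through_def by blast
qed

lemma total_weight_level:
  "k \<le> length route \<Longrightarrow> total_weight (verts T) (mutate_matrix_seq (take k route) mat) =
    (if k \<le> length S then total_weight (verts T) mat else total_weight (verts T) (mutate_matrix_seq (take (k - length S) M) mat))"
  using mutate_matrix_seq_S[of k] by (simp add: total_weight_flip_matrix mutate_matrix_seq_rev_S)

text \<open>Past \<open>length S\<close> the total weight increases strictly. Up to
  \<open>length S\<close> it is constant, and the quivers are told apart by the sets of vertices
  already flipped.\<close>

lemma level_inj:
  assumes jk: "j < k" "k \<le> length route"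
    and eq: "\<forall>u\<in>verts T. \<forall>v\<in>verts T. mutate_matrix_seq (take j route) mat u v = mutate_matrix_seq (take k route) mat u v"
  shows "j = 0 \<and> k = length S"
proof -
  have tot: "total_weight (verts T) (mutate_matrix_seq (take j route) mat) = total_weight (verts T) (mutate_matrix_seq (take k route) mat)"
    unfolding total_weight_def using eq by (intro sum.cong) auto
  have inc: "total_weight (verts T) (mutate_matrix_seq (take j M) mat) < total_weight (verts T) (mutate_matrix_seq (take k M) mat)"
    if "j < k" "k \<le> length M" for j k
    using total_weight_mutate_matrix_seq[OF finite_T fork_T M _ _ passes_through_hd_M that(2,1)] adj_p
    by (auto simp: distinct_adj_append_iff)
  show ?thesis
  proof (cases "k \<le> length S")
    case False
    then have "k - length S \<le> length M" "0 < k - length S" using jk by auto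
    then have "total_weight (verts T) mat < total_weight (verts T) (mutate_matrix_seq (take k route) mat)"
      and "\<not> j \<le> length S \<Longrightarrow> total_weight (verts T) (mutate_matrix_seq (take j route) mat) < total_weight (verts T) (mutate_matrix_seq (take k route) mat)"
      using False jk total_weight_level[of j] total_weight_level[of k] inc[of 0 "k - length S"]
        inc[of "j - length S" "k - length S"] by (simp_all del: take_append)
    then show ?thesis using tot jk total_weight_level[of j] by (cases "j \<le> length S") (simp_all del: take_append)
  next
    case True
    define D where "D k = set (take k (rev S))" for k
    have B: "mutate_matrix_seq (take j route) mat = flip_matrix (D j) mat" "mutate_matrix_seq (take k route) mat = flip_matrix (D k) mat"
      using True jk mutate_matrix_seq_S[of j] mutate_matrix_seq_S[of k] by (simp_all add: D_def)
    have mem: "rev S ! i \<in> D k \<longleftrightarrow> i < k" if "i < length S" "k \<le> length S" for i k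
    proof
      assume "rev S ! i \<in> D k"
      then obtain i' where "i' < k" "i' < length S" "rev S ! i' = rev S ! i"
        by (auto simp: D_def in_set_conv_nth)
      then show "i < k" using distinct_S that nth_eq_iff_index_eq[of "rev S" i' i] by auto
    next
      assume "i < k"
      then show "rev S ! i \<in> D k" using that by (auto simp: D_def in_set_conv_nth intro!: exI[of _ i])
    qed
    show ?thesis
    proof (rule ccontr)
      assume n: "\<not> ?thesis"
      \<comment> \<open>\<open>rev S ! j\<close> is flipped only at position \<open>k\<close>. It is
        compared with a vertex of equal status at both positions: index 0 is flipped at both, index
        \<open>k\<close> at neither. The excluded pair is the one case without such a
        vertex.\<close>
      obtain i where i: "i < length S" "i \<noteq> j" "i < j \<longleftrightarrow> i < k"
      proof (cases "k = length S")
        case True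
        then have "0 < length S" "j \<noteq> 0" using n jk by auto
        then show ?thesis using that[of 0] jk by simp
      next
        case False
        then show ?thesis using that[of k] True jk by auto
      qed
      let ?u = "rev S ! j" and ?v = "rev S ! i"
      have in': "?u \<in> verts T" "?v \<in> verts T"
        using i jk True nth_mem[of j "rev S"] nth_mem[of i "rev S"] set_S by auto
      have "?u \<noteq> ?v" using distinct_S i jk True nth_eq_iff_index_eq[of "rev S" j i] by auto
      then have "mat ?u ?v \<noteq> 0" using fork_abundant[OF fork_T, of ?u ?v] in' by auto
      moreover have "flip_sign (D j) ?u = 1" "flip_sign (D k) ?u = -1" "flip_sign (D j) ?v = flip_sign (D k) ?v" "flip_sign (D k) ?v \<noteq> 0"
        using mem[of j j] mem[of j k] mem[of i j] mem[of i k] i jk True by (auto simp: flip_sign_def)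
      ultimately have "flip_matrix (D j) mat ?u ?v \<noteq> flip_matrix (D k) mat ?u ?v" by (simp add: flip_matrix_def)
      then show False using eq in' B by simp
    qed
  qed
qed

lemma T_mut_facts: "is_quiver T_mut" "verts T_mut = verts T" "bmat T_mut = mutate_matrix_seq M mat"
  using mutate_seq_quiver[OF q, of M] by auto

lemma block_form_join_in: "block_form (verts T) (verts G) join_in (mutate_matrix_seq route mat) (\<lambda>h t. 1 * int (A t h)) (bmat G)"
  unfolding block_form_def
proof (intro conjI)
  show "is_quiver join_in" by (rule is_quiver_join) (use T_mut_facts G disj in auto)
qed (use T_mut_facts disj in \<open>auto simp: mutate_matrix_seq_rev_S bmat_def join_quiver_def T_mut_facts(3)[symmetric]\<close>)

lemma block_form_join_out: "block_form (verts T) (verts G) join_out (mutate_matrix_seq M mat) (\<lambda>h t. -1 * int (A t h)) (bmat G)"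
  unfolding block_form_def
proof (intro conjI)
  show "is_quiver join_out" by (rule is_quiver_join) (use T_mut_facts G disj in auto)
qed (use T_mut_facts disj in \<open>auto simp: bmat_def join_quiver_def T_mut_facts(3)[symmetric]\<close>)

lemma block_form_first:
  assumes "k \<le> length route"
  shows "block_form (verts T) (verts G) (mutate_seq (rev (drop k route)) join_in) (mutate_matrix_seq (take k route) mat)
    (\<lambda>h. pull_back (mutate_matrix_seq (take k route) mat) (drop k route) (\<lambda>t. 1 * int (A t h))) (bmat G)"
proof -
  have adj': "distinct_adj (take k route @ drop k route)" using adj_p by (simp only: append_take_drop_id)
  then obtain P where P: "fork (verts T) P (mutate_matrix_seq (take k route) mat)" "drop k route \<noteq> [] \<Longrightarrow> hd (drop k route) \<notin> P"
    using fork_mutate_matrix_seq[OF fork_T _ adj'] set_p by (metis Un_iff append_take_drop_id empty_iff set_append subsetI subset_iff)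
  show ?thesis
  proof (rule block_form_pull_back[OF finite_T disj _ _ P(1) _ _ P(2)])
    show "set (drop k route) \<subseteq> verts T" using set_p set_drop_subset by fast
    show "distinct_adj (drop k route)" using adj' by (auto simp only: distinct_adj_append_iff)
    show "block_form (verts T) (verts G) join_in (mutate_matrix_seq (drop k route) (mutate_matrix_seq (take k route) mat)) (\<lambda>h t. 1 * int (A t h)) (bmat G)"
      using block_form_join_in mutate_matrix_seq_simps(3)[of "take k route" "drop k route" mat] by (simp only: append_take_drop_id)
  qed auto
qed

lemma block_form_second:
  assumes "k \<le> length M"
  shows "block_form (verts T) (verts G) (mutate_seq (rev (drop k M)) join_out) (mutate_matrix_seq (take k M) mat)
    (\<lambda>h. pull_back (mutate_matrix_seq (take k M) mat) (drop k M) (\<lambda>t. -1 * int (A t h))) (bmat G)"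
proof -
  have adj': "distinct_adj (take k M @ drop k M)" using adj by (simp add: distinct_adj_append_iff)
  then obtain P where P: "fork (verts T) P (mutate_matrix_seq (take k M) mat)" "drop k M \<noteq> [] \<Longrightarrow> hd (drop k M) \<notin> P"
    using fork_mutate_matrix_seq[OF fork_T _ adj'] M by (metis Un_iff append_take_drop_id empty_iff set_append subsetI subset_iff)
  show ?thesis
  proof (rule block_form_pull_back[OF finite_T disj _ _ P(1) _ _ P(2)])
    show "set (drop k M) \<subseteq> verts T" using M set_drop_subset by fast
    show "distinct_adj (drop k M)" using adj' by (auto simp only: distinct_adj_append_iff)
    show "block_form (verts T) (verts G) join_out (mutate_matrix_seq (drop k M) (mutate_matrix_seq (take k M) mat)) (\<lambda>h t. -1 * int (A t h)) (bmat G)"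
      using block_form_join_out mutate_matrix_seq_simps(3)[of "take k M" "drop k M" mat] by (simp only: append_take_drop_id)
  qed auto
qed

lemma is_quiver_join_in: "is_quiver join_in" and is_quiver_join_out: "is_quiver join_out"
  using block_form_join_in block_form_join_out by (auto simp: block_form_def)

text \<open>This is the quiver reached after \<open>rev M @ S\<close>, when the
  \<open>T\<close>-part is \<open>T\<close> itself; \<open>pull_back_sinks\<close> identifies the
  two descriptions of its remaining arrows.\<close>

lemma mutate_to_middle: "mutate_seq (rev route) join_in = mutate_seq (rev M) join_out"
proof (rule block_form_unique)
  show "block_form (verts T) (verts G) (mutate_seq (rev route) join_in) mat
    (\<lambda>h. pull_back mat route (\<lambda>t. 1 * int (A t h))) (bmat G)"
    using block_form_first[of 0] by simp
  show "block_form (verts T) (verts G) (mutate_seq (rev M) join_out) mat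
    (\<lambda>h. pull_back mat M (\<lambda>t. -1 * int (A t h))) (bmat G)"
    using block_form_second[of 0] by simp
  show "\<forall>h\<in>verts G. \<forall>t\<in>verts T. pull_back mat route (\<lambda>t. 1 * int (A t h)) t = pull_back mat M (\<lambda>t. -1 * int (A t h)) t"
    using pull_back_sinks[OF finite_T fork_T, of "rev S" M "\<lambda>t. int (A t _)"] bmat_zero[OF q] distinct_S set_S
      sorted_rev_S M adj_p by simp
qed

lemma half_cycle: "mutate_seq half join_in = join_out"
proof -
  have "mutate_seq half join_in = mutate_seq M (mutate_seq (rev route) join_in)" by simp
  also have "\<dots> = mutate_seq (rev (rev M)) (mutate_seq (rev M) join_out)" unfolding mutate_to_middle by simp
  also have "\<dots> = join_out" by (rule mutate_seq_rev[OF is_quiver_join_out])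
  finally show ?thesis .
qed

text \<open>Past the middle the quivers are described from the far end \<open>join_out\<close>,
  where the pull-back along the rest of \<open>M\<close> applies.\<close>

lemma second_half:
  assumes "k \<le> length M"
  shows "mutate_seq (take (length route + k) half) join_in = mutate_seq (rev (drop k M)) join_out"
proof -
  have "take (length route + k) half = rev route @ take k M" by simp
  then have "mutate_seq (take (length route + k) half) join_in = mutate_seq (take k M) (mutate_seq (rev route) join_in)"
    by (simp only: mutate_seq_simps)
  also have "\<dots> = mutate_seq (take k M) (mutate_seq (rev (take k M @ drop k M)) join_out)"
    unfolding mutate_to_middle by simp
  also have "\<dots> = mutate_seq (rev (rev (take k M))) (mutate_seq (rev (take k M)) (mutate_seq (rev (drop k M)) join_out))"
    by (simp only: rev_append mutate_seq_simps rev_rev_ident)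
  also have "\<dots> = mutate_seq (rev (drop k M)) join_out"
    using mutate_seq_quiver[OF is_quiver_join_out] by (intro mutate_seq_rev) blast
  finally show ?thesis .
qed

section \<open>Recurrence of the T-part within half a cycle\<close>

text \<open>
  At time \<open>i\<close> of the half cycle the \<open>T\<close>-part has come back to the quiver at position \<open>level i\<close> of the
  outward route; positions 0 and \<open>length S\<close> carry the same quiver \<open>T\<close>.
\<close>

definition level :: "nat \<Rightarrow> nat" where
  "level i = (if i \<le> length route then length route - i else length S + (i - length route))"

lemma block_form_level:
  assumes "i \<le> length half"
  shows "\<exists>x. block_form (verts T) (verts G) (mutate_seq (take i half) join_in) (mutate_matrix_seq (take (level i) route) mat) x (bmat G)"
proof (cases "i \<le> length route")
  case True
  have "take i half = take i (rev route @ M)" by simp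
  also have "\<dots> = rev (drop (level i) route)"
    using True by (simp only: take_append level_def take_rev) simp
  finally show ?thesis using block_form_first[of "level i"] True by (metis diff_le_self level_def)
next
  case False
  then obtain k where k: "i = length route + k" "k > 0" "k \<le> length M"
    using assms by (metis (no_types, lifting) add_diff_inverse_nat append_assoc diff_le_mono
      diff_add_inverse length_append length_rev nat_le_linear not_less rev_append rev_rev_ident
      zero_less_diff add.commute add_le_cancel_left le_add_diff_inverse)
  have "mutate_matrix_seq (take (level i) route) mat = mutate_matrix_seq (take k M) mat"
    using k by (simp add: level_def mutate_matrix_seq_rev_S)
  then show ?thesis using block_form_second[OF k(3)] second_half[OF k(3)] k(1) by metis
qed

lemma G_block:
  "i \<le> length half \<Longrightarrow> u \<in> verts G \<Longrightarrow> v \<in> verts G \<Longrightarrow> bmat (mutate_seq (take i half) join_in) u v = bmat G u v"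
  using block_form_level[of i] by (auto simp: block_form_def)

text \<open>Two times of equal level are mirror images. The exceptional levels 0 and
  \<open>length S\<close> occur at the times \<open>length route\<close> and
  \<open>length M\<close>, which are mirrored too.\<close>

lemma T_block_inj:
  assumes ij: "i < j" "j \<le> length half"
    and eq: "\<forall>u\<in>verts T. \<forall>v\<in>verts T. bmat (mutate_seq (take i half) join_in) u v = bmat (mutate_seq (take j half) join_in) u v"
  shows "i + j = length half \<and> i \<le> length M"
proof -
  obtain x y where "block_form (verts T) (verts G) (mutate_seq (take i half) join_in) (mutate_matrix_seq (take (level i) route) mat) x (bmat G)"
    "block_form (verts T) (verts G) (mutate_seq (take j half) join_in) (mutate_matrix_seq (take (level j) route) mat) y (bmat G)"
    using block_form_level[of i] block_form_level[of j] ij by auto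
  then have e: "\<forall>u\<in>verts T. \<forall>v\<in>verts T. mutate_matrix_seq (take (level i) route) mat u v = mutate_matrix_seq (take (level j) route) mat u v"
    using eq by (simp add: block_form_def)
  have l: "level i \<le> length route" "level j \<le> length route" using ij by (auto simp: level_def)
  have "level i = level j \<or> level i = 0 \<and> level j = length S \<or> level j = 0 \<and> level i = length S"
    using level_inj[of "level i" "level j"] level_inj[of "level j" "level i"] l e by (metis nat_neq_iff)
  then show ?thesis using ij by (auto simp: level_def split: if_splits)
qed

text \<open>\<open>half\<close> begins with \<open>rev M\<close> and ends with \<open>M\<close>, so
  at mirrored times the way back to \<open>join_in\<close> is also the way on to
  \<open>join_out\<close>. Equal quivers there would force \<open>join_in = join_out\<close>,
  although a nonzero entry of \<open>A\<close> is reversed.\<close>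

lemma distinct_half:
  assumes A: "\<exists>t\<in>verts T. \<exists>h\<in>verts G. A t h \<noteq> 0" and ij: "i < j" "j \<le> length half"
  shows "mutate_seq (take i half) join_in \<noteq> mutate_seq (take j half) join_in"
proof
  assume eq: "mutate_seq (take i half) join_in = mutate_seq (take j half) join_in"
  then have s: "i + j = length half" "i \<le> length M" using T_block_inj[OF ij] by auto
  have "join_in = mutate_seq (rev (take i half)) (mutate_seq (take i half) join_in)"
    by (rule mutate_seq_rev[OF is_quiver_join_in, symmetric])
  also have "rev (take i half) = drop j half"
  proof -
    have "drop j half = drop (length M - i) M"
    proof -
      have "j = length M + length S + (length M - i)" using s by simp
      then show ?thesis by simp
    qed
    then show ?thesis using s(2) by (simp add: take_rev)
  qed
  also have "mutate_seq (drop j half) (mutate_seq (take i half) join_in) = mutate_seq (take j half @ drop j half) join_in"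
    unfolding eq by (simp only: mutate_seq_simps)
  also have "\<dots> = join_out" by (simp only: append_take_drop_id half_cycle)
  finally have *: "join_in = join_out" .
  obtain t h where "t \<in> verts T" "h \<in> verts G" "A t h \<noteq> 0" using A by blast
  then show False using block_form_join_in block_form_join_out unfolding * by (auto simp: block_form_def)
qed

end

section \<open>Both halves combined, with the roles of H and T exchanged\<close>

theorem theorem4p23:
  fixes H T :: "'a quiver"
    and S_H S_T N M :: "'a list"
    and A :: "'a \<Rightarrow> 'a \<Rightarrow> nat"
  assumes "is_quiver H" and "abundant H" and "acyclic_quiver H"
    and "is_quiver T" and "abundant T" and "acyclic_quiver T"
    and "verts H \<inter> verts T = {}"
    and "reddening_source_sequence H S_H"
    and "reddening_source_sequence T S_T"
    and "set N \<subseteq> verts H"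
    and "set M \<subseteq> verts T"
    and "distinct_adj (rev M @ S_T @ M @ rev N @ S_H @ N)"
    and "\<exists>t\<in>verts T. \<exists>h\<in>verts H. A t h \<noteq> 0"
  shows "simple_mutation_cycle
           (join_quiver (mutate_seq M T) A (mutate_seq N H))
           (rev M @ S_T @ M @ rev N @ S_H @ N)"
proof -
  define T' where "T' = mutate_seq M T"
  define H' where "H' = mutate_seq N H"
  define LT where "LT = rev M @ S_T @ M"
  define LH where "LH = rev N @ S_H @ N"
  define Q where "Q = join_quiver T' A H'"
  define Q' where "Q' = join_quiver H' (\<lambda>h t. A t h) T'"
  have T': "is_quiver T'" "verts T' = verts T" and H': "is_quiver H'" "verts H' = verts H"
    using mutate_seq_quiver assms(1,4) unfolding T'_def H'_def by blast+
  have full: "rev M @ S_T @ M @ rev N @ S_H @ N = LT @ LH" by (simp add: LT_def LH_def)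
  have adj: "distinct_adj (rev M @ S_T @ M)" "distinct_adj (rev N @ S_H @ N)"
    using assms(12)[unfolded full distinct_adj_append_iff] unfolding LT_def LH_def by blast+
  have dT: "verts T \<inter> verts H' = {}" and dH: "verts H \<inter> verts T' = {}" using assms(7) T' H' by auto
  note hypT = assms(4-6,9,11) adj(1) H'(1) dT
  note hypH = assms(1-3,8,10) adj(2) T'(1) dH
  have cycT: "mutate_seq LT Q = Q'"
    using half_cycle[OF hypT, of A] by (simp add: LT_def Q_def Q'_def T'_def)
  have cycH: "mutate_seq LH Q' = Q"
    using half_cycle[OF hypH, of "\<lambda>h t. A t h"] by (simp add: LH_def Q_def Q'_def H'_def)
  have distT: "mutate_seq (take i LT) Q \<noteq> mutate_seq (take j LT) Q" if "i < j" "j \<le> length LT" for i j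
    using distinct_half[OF hypT, of A i j] that assms(13) H'(2) by (simp add: LT_def Q_def T'_def)
  have distH: "mutate_seq (take i LH) Q' \<noteq> mutate_seq (take j LH) Q'" if "i < j" "j \<le> length LH" for i j
    using distinct_half[OF hypH, of "\<lambda>h t. A t h" i j] that assms(13) T'(2) by (auto simp: LH_def Q'_def H'_def)
  define q where "q k = mutate_seq (take k (LT @ LH)) Q" for k
  have qT: "q i = mutate_seq (take i LT) Q" if "i \<le> length LT" for i using that by (simp add: q_def)
  have qH: "q i = mutate_seq (take (i - length LT) LH) Q'" if "i \<ge> length LT" for i
    using that by (simp add: q_def cycT)
  have ne: "q i \<noteq> q j" if ij: "i < j" "j < length LT + length LH" for i j
  proof -
    consider "j \<le> length LT" | "length LT \<le> i" | "i < length LT" "length LT < j" by linarith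
    then show ?thesis
    proof cases
      case 1
      then show ?thesis using distT[of i j] ij qT by simp
    next
      case 2
      then show ?thesis using distH[of "i - length LT" "j - length LT"] ij qH by simp
    next
      case 3
      show ?thesis
      proof
        assume eq: "q i = q j"
        let ?j = "j - length LT"
        have Hi: "bmat (q i) u v = bmat H' u v" if "u \<in> verts H" "v \<in> verts H" for u v
          \<comment> \<open>During the first half the \<open>H\<close>-block stays
            \<open>H'\<close>. So a coincidence with time \<open>j\<close> in the second half would
            show \<open>H'\<close> there as well as at the end of the cycle; by
            \<open>T_block_inj\<close> for \<open>H\<close>, the time mirrored to the end is the
            start of that half, which \<open>j\<close> has already passed.\<close>
          using G_block[OF hypT, of i u v A] 3 that H'(2) qT[of i] by (simp add: LT_def Q_def T'_def)
        have Hend: "bmat (mutate_seq (take (length LH) LH) Q') u v = bmat H' u v"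
          if "u \<in> verts H" "v \<in> verts H" for u v
          using G_block[OF hypT, of 0 u v A] that H'(2) cycH by (simp add: Q_def T'_def)
        have "\<forall>u\<in>verts H. \<forall>v\<in>verts H. bmat (mutate_seq (take ?j LH) Q') u v
            = bmat (mutate_seq (take (length LH) LH) Q') u v"
          using Hi Hend eq qH[of j] 3 by simp
        then have "?j + length LH = length LH"
          using T_block_inj[OF hypH, of ?j "length LH" "\<lambda>h t. A t h"] ij 3
          by (simp add: LH_def Q'_def H'_def)
        then show False using 3 by simp
      qed
    qed
  qed
  have "mutate_seq (LT @ LH) Q = Q" using cycT cycH by simp
  moreover have "set (LT @ LH) \<subseteq> verts Q"
    using assms(8-11) T' H' 
    by (auto simp: LT_def LH_def Q_def join_quiver_def reddening_source_sequence_def source_sequence_def)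
  moreover have "distinct (map q [0..<length (LT @ LH)])"
    unfolding distinct_map
  proof (intro conjI inj_onI distinct_upt)
    fix i j assume "i \<in> set [0..<length (LT @ LH)]" "j \<in> set [0..<length (LT @ LH)]" "q i = q j"
    then show "i = j" using ne[of i j] ne[of j i] by (cases i j rule: linorder_cases) auto
  qed
  ultimately show ?thesis
    using assms(12) unfolding simple_mutation_cycle_def mutation_cycle_def full
      T'_def[symmetric] H'_def[symmetric] Q_def[symmetric] q_def[abs_def] by blast
qed

end
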